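(* Let $I_{ijk}$ be the coefficients of the symmetric tensors $\Theta_m$ with respect to the $\mathrm{SL}_3(\mathbb{C})$-invariant coframe $\omega_1,\omega_2,\omega_3$ defined in the context, $$\Theta_m=\sum_{i+j+k=m}I_{ijk}\frac{\omega_1^i}{i!}\frac{\omega_2^j}{j!}\frac{\omega_3^k}{k!}.$$ Then the functions $I_{ijk}$ are $\mathrm{SL}_3$-invariants of order $(i+j+k)$, and any rational differential invariant is a rational function of them.
   Context: Setting: the $\mathrm{SL}_3(\mathbb{C})$-classification of ternary forms (homogeneous polynomials on $\mathbb{C}^3$) of arbitrary degree $n$, regarded as solutions of the Euler equation $xf_x+yf_y+zf_z=nf$. $\mathbf{J}^k$ is the space of $k$-jets of functions on $\mathbb{C}^3$ with canonical coordinates $x,y,z,u_{abc}$ ($0\le a+b+c\le k$), where $u_{abc}([f]^k_p)=\frac{\partial^{a+b+c}f}{\partial x^a\partial y^b\partial z^c}(p)$. The group $\mathrm{SL}_3(\mathbb{C})$ acts linearly on $\mathbb{C}^3$, on functions by $Bf=f\circ B^{-1}$, and on $\mathbf{J}^k$ by $B^{(k)}([f]_p^k)=[Bf]^k_{Bp}$. $\mathcal{E}_1\subset\mathbf{J}^1$ is given by $xu_{100}+yu_{010}+zu_{001}=nu_{000}$, and $\mathcal{E}_k\subset\mathbf{J}^k$ is the collection of all prolongations of this equation up to order $k$. A (rational) differential $\mathrm{SL}_3$-invariant of order $k$ is a rational function $I$ on $\mathcal{E}_k$ with $I\circ B^{(k)}=I$ for all $B\in\mathrm{SL}_3(\mathbb{C})$.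 Symmetric tensors: $\Theta_m=\sum_{i+j+k=m}u_{ijk}\frac{dx^i}{i!}\frac{dy^j}{j!}\frac{dz^k}{k!}$. Coframe: let $$A=u_{002}u_{020}u_{200}-u_{002}u_{110}^2-u_{011}^2u_{200}+2u_{011}u_{101}u_{110}-u_{020}u_{101}^2,$$ and let $A_1=\frac{dA}{dx}$, $A_2=\frac{dA}{dy}$, $A_3=\frac{dA}{dz}$ be its total derivatives. Then $$\omega_1=u_{100}dx+u_{010}dy+u_{001}dz,\qquad \omega_2=A_1dx+A_2dy+A_3dz,\qquad \omega_3=F_1dx+F_2dy+F_3dz,$$ with $$F_1=(u_{001}u_{110}-u_{010}u_{101})A_1+(-u_{001}u_{200}+u_{100}u_{101})A_2+(u_{010}u_{200}-u_{100}u_{110})A_3,$$ $$F_2=(u_{001}u_{020}-u_{010}u_{011})A_1+(-u_{001}u_{110}+u_{011}u_{100})A_2+(u_{010}u_{110}-u_{020}u_{100})A_3,$$ $$F_3=(u_{001}u_{011}-u_{002}u_{010})A_1+(-u_{001}u_{101}+u_{002}u_{100})A_2+(u_{010}u_{101}-u_{011}u_{100})A_3.$$ (The form $\omega_3$ is orthogonal to $\omega_1=\Theta_1$ and $\omega_2$ with respect to the inverse of $\Theta_2$.) The forms $dx,dy,dz$ are expressed through $\omega_1,\omega_2,\omega_3$ by inverting these relations, which gives the expression of $\Theta_m$ in the coframe.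
   Formalization: For i+j+k=2 the invariants are stated to be of order 3, not 2 (the coframe contains third derivatives); the degree n=1 is excluded, as there A=0 and no coframe exists; rational functions are taken on the part of the equation over nonzero points, since over the origin the coframe degenerates. *)

theory Defs
  imports "HOL-Analysis.Analysis"
begin

section \<open>Jets of functions on three-dimensional complex space\<close>

text \<open>
  A point of the jet space is a pair of a base point and a family \<open>u\<close> with \<open>u a b c\<close> the
  coordinate $u_{abc}$. Jets of order \<open>k\<close> are those with \<open>u a b c = 0\<close> whenever
  \<open>a + b + c > k\<close>, so the projection from jets of order \<open>l\<close> to jets of order \<open>k\<close> is \<open>truncate k\<close>.
\<close>

type_synonym jet = "(complex^3) \<times> (nat \<Rightarrow> nat \<Rightarrow> nat \<Rightarrow> complex)"

definition partial :: "3 \<Rightarrow> (complex^3 \<Rightarrow> complex) \<Rightarrow> complex^3 \<Rightarrow> complex" where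
  "partial i f p = deriv (\<lambda>t. f (p + t *s axis i 1)) 0"

definition partials :: "nat \<Rightarrow> nat \<Rightarrow> nat \<Rightarrow> (complex^3 \<Rightarrow> complex) \<Rightarrow> complex^3 \<Rightarrow> complex" where
  "partials a b c f = (partial 1 ^^ a) ((partial 2 ^^ b) ((partial 3 ^^ c) f))"

definition jet_of :: "nat \<Rightarrow> (complex^3 \<Rightarrow> complex) \<Rightarrow> complex^3 \<Rightarrow> jet" where
  "jet_of k f p = (p, \<lambda>a b c. if a + b + c \<le> k then partials a b c f p else 0)"

definition jet_space :: "nat \<Rightarrow> jet set" where
  "jet_space k = {\<theta>. \<forall>a b c. k < a + b + c \<longrightarrow> snd \<theta> a b c = 0}"

definition truncate :: "nat \<Rightarrow> jet \<Rightarrow> jet" where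
  "truncate k \<theta> = (fst \<theta>, \<lambda>a b c. if a + b + c \<le> k then snd \<theta> a b c else 0)"

text \<open>
  A symmetric tensor of degree \<open>m\<close> is identified with the homogeneous polynomial it defines on
  tangent vectors; \<open>sym_form m u\<close> is then
  $\sum_{i+j+k=m} u_{ijk} \frac{dx^i}{i!}\frac{dy^j}{j!}\frac{dz^k}{k!}$, that is, $\Theta_m$.
\<close>

definition sym_form :: "nat \<Rightarrow> (nat \<Rightarrow> nat \<Rightarrow> nat \<Rightarrow> complex) \<Rightarrow> complex^3 \<Rightarrow> complex" where
  "sym_form m u v = (\<Sum>(i, j, k) \<in> {(i, j, k). i + j + k = m}.
     u i j k * (v $ 1 ^ i / fact i) * (v $ 2 ^ j / fact j) * (v $ 3 ^ k / fact k))"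

definition taylor :: "nat \<Rightarrow> jet \<Rightarrow> complex^3 \<Rightarrow> complex" where
  "taylor k \<theta> q = (\<Sum>m\<le>k. sym_form m (snd \<theta>) (q - fst \<theta>))"

text \<open>
  The next two notions are defined on jets through a representing function; neither depends on
  the representative, and the Taylor polynomial is used.
  \<open>prolong k B\<close> sends the jet of \<open>f\<close> at \<open>p\<close> to the jet of $f \circ B^{-1}$ at \<open>B p\<close>.
  \<open>total_deriv l a b c F\<close> is the iterated total derivative of the function \<open>F\<close> of jets of
  order \<open>l\<close>: its value at the jet of \<open>f\<close> at \<open>p\<close> is the partial derivative at \<open>p\<close> of \<open>F\<close>
  composed with the \<open>l\<close>-jet section of \<open>f\<close>.
\<close>

definition prolong :: "nat \<Rightarrow> complex^3^3 \<Rightarrow> jet \<Rightarrow> jet" where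
  "prolong k B \<theta> = jet_of k (\<lambda>q. taylor k \<theta> (matrix_inv B *v q)) (B *v fst \<theta>)"

definition total_deriv :: "nat \<Rightarrow> nat \<Rightarrow> nat \<Rightarrow> nat \<Rightarrow> (jet \<Rightarrow> complex) \<Rightarrow> jet \<Rightarrow> complex" where
  "total_deriv l a b c F \<theta> =
     partials a b c (\<lambda>q. F (jet_of l (taylor (l + a + b + c) \<theta>) q)) (fst \<theta>)"


section \<open>The Euler equation and rational differential invariants\<close>

definition euler :: "nat \<Rightarrow> jet \<Rightarrow> complex" where
  "euler n \<theta> = fst \<theta> $ 1 * snd \<theta> 1 0 0 + fst \<theta> $ 2 * snd \<theta> 0 1 0 + fst \<theta> $ 3 * snd \<theta> 0 0 1
     - of_nat n * snd \<theta> 0 0 0"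

definition euler_eq :: "nat \<Rightarrow> nat \<Rightarrow> jet set" where
  "euler_eq n k =
     {\<theta> \<in> jet_space k. \<forall>a b c. a + b + c < k \<longrightarrow> total_deriv 1 a b c (euler n) \<theta> = 0}"

text \<open>
  The equation is singular over the origin, where the Euler field vanishes: for \<open>k > n \<ge> 2\<close> the
  fibre over the origin is a separate irreducible component, on which $\omega_1 = 0$
  and the coframe below degenerates. Rational functions are taken on the regular part, a vector
  bundle over the complement of the origin and hence irreducible; for \<open>k \<le> n\<close> it is dense.
\<close>

definition regular_part :: "nat \<Rightarrow> nat \<Rightarrow> jet set" where
  "regular_part n k = {\<theta> \<in> euler_eq n k. fst \<theta> \<noteq> 0}"

inductive_set algebra_gen :: "('a \<Rightarrow> complex) set \<Rightarrow> ('a \<Rightarrow> complex) set" for G where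
  const: "(\<lambda>_. c) \<in> algebra_gen G"
| gen: "g \<in> G \<Longrightarrow> g \<in> algebra_gen G"
| add: "f \<in> algebra_gen G \<Longrightarrow> g \<in> algebra_gen G \<Longrightarrow> (\<lambda>x. f x + g x) \<in> algebra_gen G"
| mult: "f \<in> algebra_gen G \<Longrightarrow> g \<in> algebra_gen G \<Longrightarrow> (\<lambda>x. f x * g x) \<in> algebra_gen G"

definition coordinates :: "nat \<Rightarrow> (jet \<Rightarrow> complex) set" where
  "coordinates k = {\<lambda>\<theta>. fst \<theta> $ i |i. True} \<union> {\<lambda>\<theta>. snd \<theta> a b c |a b c. a + b + c \<le> k}"

abbreviation polynomial_functions :: "nat \<Rightarrow> (jet \<Rightarrow> complex) set" where
  "polynomial_functions k \<equiv> algebra_gen (coordinates k)"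

text \<open>\<open>generically n k \<phi>\<close>: \<open>\<phi>\<close> holds on a nonempty Zariski open subset.\<close>

definition generically :: "nat \<Rightarrow> nat \<Rightarrow> (jet \<Rightarrow> bool) \<Rightarrow> bool" where
  "generically n k \<phi> \<longleftrightarrow> (\<exists>S \<in> polynomial_functions k.
     (\<exists>\<theta> \<in> regular_part n k. S \<theta> \<noteq> 0) \<and> (\<forall>\<theta> \<in> regular_part n k. S \<theta> \<noteq> 0 \<longrightarrow> \<phi> \<theta>))"

text \<open>
  A rational function is given by any total function that agrees with it generically; its values
  elsewhere are irrelevant, and equality of rational functions is generic equality.
\<close>

definition rational_in :: "nat \<Rightarrow> nat \<Rightarrow> (jet \<Rightarrow> complex) set \<Rightarrow> (jet \<Rightarrow> complex) \<Rightarrow> bool" where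
  "rational_in n k G F \<longleftrightarrow> (\<exists>P \<in> algebra_gen G. \<exists>Q \<in> algebra_gen G.
     generically n k (\<lambda>\<theta>. Q \<theta> \<noteq> 0 \<and> F \<theta> = P \<theta> / Q \<theta>))"

definition rational_invariant :: "nat \<Rightarrow> nat \<Rightarrow> (jet \<Rightarrow> complex) \<Rightarrow> bool" where
  "rational_invariant n k F \<longleftrightarrow> rational_in n k (coordinates k) F \<and>
     (\<forall>B. det B = 1 \<longrightarrow> generically n k (\<lambda>\<theta>. F (prolong k B \<theta>) = F \<theta>))"

text \<open>
  \<open>F\<close>, a function of jets of order at least \<open>l\<close>, is the pullback of a rational invariant of
  order \<open>k \<le> l\<close>.
\<close>

definition invariant_of_order :: "nat \<Rightarrow> nat \<Rightarrow> nat \<Rightarrow> (jet \<Rightarrow> complex) \<Rightarrow> bool" where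
  "invariant_of_order n l k F \<longleftrightarrow> (\<exists>J. rational_invariant n k J \<and>
     generically n l (\<lambda>\<theta>. F \<theta> = J (truncate k \<theta>)))"


section \<open>The invariant coframe\<close>

definition hess :: "jet \<Rightarrow> complex" where
  "hess \<theta> = (let u = snd \<theta> in
     u 0 0 2 * u 0 2 0 * u 2 0 0 - u 0 0 2 * (u 1 1 0)^2 - (u 0 1 1)^2 * u 2 0 0
     + 2 * u 0 1 1 * u 1 0 1 * u 1 1 0 - u 0 2 0 * (u 1 0 1)^2)"

definition coframe :: "jet \<Rightarrow> complex^3^3" where
  "coframe \<theta> = (let u = snd \<theta>;
     A1 = total_deriv 2 1 0 0 hess \<theta>;
     A2 = total_deriv 2 0 1 0 hess \<theta>;
     A3 = total_deriv 2 0 0 1 hess \<theta>;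
     F1 = (u 0 0 1 * u 1 1 0 - u 0 1 0 * u 1 0 1) * A1
        + (- u 0 0 1 * u 2 0 0 + u 1 0 0 * u 1 0 1) * A2
        + (u 0 1 0 * u 2 0 0 - u 1 0 0 * u 1 1 0) * A3;
     F2 = (u 0 0 1 * u 0 2 0 - u 0 1 0 * u 0 1 1) * A1
        + (- u 0 0 1 * u 1 1 0 + u 0 1 1 * u 1 0 0) * A2
        + (u 0 1 0 * u 1 1 0 - u 0 2 0 * u 1 0 0) * A3;
     F3 = (u 0 0 1 * u 0 1 1 - u 0 0 2 * u 0 1 0) * A1
        + (- u 0 0 1 * u 1 0 1 + u 0 0 2 * u 1 0 0) * A2
        + (u 0 1 0 * u 1 0 1 - u 0 1 1 * u 1 0 0) * A3
   in vector [vector [u 1 0 0, u 0 1 0, u 0 0 1], vector [A1, A2, A3], vector [F1, F2, F3]])"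

text \<open>
  Row \<open>r\<close> of \<open>coframe \<theta>\<close> lists the components of $\omega_r$, so \<open>coframe \<theta> *v v\<close> is the
  vector of the values $\omega_r(v)$, and the equation below reads
  $\Theta_m = \sum_{i+j+k=m} I_{ijk} \frac{\omega_1^i}{i!}\frac{\omega_2^j}{j!}\frac{\omega_3^k}{k!}$.
  It determines the coefficients uniquely where the forms are linearly independent; elsewhere the
  value is unspecified. Since the coframe involves third derivatives, the coefficients with
  \<open>i + j + k = 2\<close> are in general of order 3 and not 2. For \<open>n = 1\<close> the Euler equation forces
  \<open>hess = 0\<close>, so there is no coframe.
\<close>

definition coeff_inv :: "nat \<Rightarrow> nat \<Rightarrow> nat \<Rightarrow> jet \<Rightarrow> complex" where
  "coeff_inv i j k \<theta> = (THE I. \<forall>m v.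
     sym_form m (snd \<theta>) v = sym_form m I (coframe \<theta> *v v)) i j k"

end

theory Submission
  imports Defs
begin

text \<open>
  Under a linear change of coordinates by the coframe $C$ at a jet $(p, u)$, the derivatives $u$
  become the coefficients $I_{ijk}$ and the base point becomes $C p$, which by Euler's equation is
  $(n I_{000}, 3(n-2) A, 0)$. Orthogonality of $\omega_3$ to $\omega_1$ and $\omega_2$ gives
  $\det C = 1 / I_{002}$, hence $A$ is rational in the $I_{ijk}$ as well. Rescaling $\omega_3$ turns
  $C$ into a matrix of determinant 1, so an invariant has the same value at a jet as at the
  normalised jet, and there it is a rational function of the $I_{ijk}$.
\<close>

text \<open>For a fixed matrix B invariance holds only generically, with an exceptional set that may
  depend on B, whereas the normalising matrix depends on the jet. Writing the invariant as P / Q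
  turns invariance into the polynomial identity P(B \<theta>) Q(\<theta>) = P(\<theta>) Q(B
  \<theta>). As the regular part is irreducible, this identity holds at each of its jets, so B may
  then vary with \<theta>. Irreducibility is shown by joining two jets by a rational curve, moved by
  matrices that need not have determinant 1; the Euler equation is preserved by all invertible ones.
  Derivatives are handled algebraically: Taylor polynomials represent jets, and families of
  derivatives are compared through their homogeneous forms, which determine them.\<close>

text \<open>
  On the derivatives \<open>u\<close> of a function \<open>f\<close>, \<open>shift v\<close> is the derivative along \<open>v\<close>, and
  \<open>pull M u\<close> lists the derivatives of $f \circ M$.
\<close>

type_synonym family = "nat \<Rightarrow> nat \<Rightarrow> nat \<Rightarrow> complex"

definition shift :: "complex^3 \<Rightarrow> family \<Rightarrow> family" where
  "shift v u = (\<lambda>a b c. v $ 1 * u (Suc a) b c + v $ 2 * u a (Suc b) c + v $ 3 * u a b (Suc c))"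

definition pull :: "complex^3^3 \<Rightarrow> family \<Rightarrow> family" where
  "pull M u = (\<lambda>a b c. (shift (column 1 M) ^^ a) ((shift (column 2 M) ^^ b)
     ((shift (column 3 M) ^^ c) u)) 0 0 0)"

lemma shift_commute: "shift v (shift w u) = shift w (shift v u)"
  by (simp add: shift_def fun_eq_iff algebra_simps)

lemma shift_lincomb:
  "shift v (\<lambda>a b c. x * f a b c + y * g a b c) = (\<lambda>a b c. x * shift v f a b c + y * shift v g a b c)"
  by (simp add: shift_def fun_eq_iff algebra_simps)

lemma shift_funpow_lincomb:
  "(shift v ^^ m) (\<lambda>a b c. x * f a b c + y * g a b c) =
     (\<lambda>a b c. x * (shift v ^^ m) f a b c + y * (shift v ^^ m) g a b c)"
  by (induction m) (simp_all add: shift_lincomb)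

lemma pull_lincomb:
  "pull M (\<lambda>a b c. x * f a b c + y * g a b c) = (\<lambda>a b c. x * pull M f a b c + y * pull M g a b c)"
  by (simp add: pull_def shift_funpow_lincomb)

lemma pull_scale: "pull M (\<lambda>a b c. x * f a b c) = (\<lambda>a b c. x * pull M f a b c)"
  using pull_lincomb[of M x f 0 f] by simp

lemma pull_0 [simp]: "pull M u 0 0 0 = u 0 0 0"
  by (simp add: pull_def)

lemma shift_funpow_commute: "(shift v ^^ m) (shift w u) = shift w ((shift v ^^ m) u)"
  by (induction m) (simp_all add: shift_commute)

text \<open>Chain rule: the derivative of f o M along v is that of f along M v, composed with M. As
  shifts commute, raising an index of \<open>pull M u\<close> amounts to first shifting
  \<open>u\<close> along the corresponding column.\<close>

lemma shift_pull: "shift v (pull M u) = pull M (shift (M *v v) u)"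
proof (intro ext)
  fix a b c
  let ?s = "\<lambda>j. shift (column j M) u"
  have Suc: "pull M u (Suc a) b c = pull M (?s 1) a b c" "pull M u a (Suc b) c = pull M (?s 2) a b c"
    "pull M u a b (Suc c) = pull M (?s 3) a b c"
    by (simp_all add: pull_def shift_funpow_commute)
  have lin: "shift (M *v v) u =
      (\<lambda>a b c. v $ 1 * ?s 1 a b c + 1 * (v $ 2 * ?s 2 a b c + v $ 3 * ?s 3 a b c))"
    by (simp add: shift_def fun_eq_iff matrix_vector_mult_def sum_3 column_def algebra_simps)
  show "shift v (pull M u) a b c = pull M (shift (M *v v) u) a b c"
    unfolding lin pull_lincomb by (simp add: shift_def[of v] Suc)
qed

subsection \<open>Symmetric forms\<close>

lemma finite_degree [simp]: "finite {(i, j, k). i + j + k = (m::nat)}"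
  by (rule finite_subset[of _ "{..m} \<times> {..m} \<times> {..m}"]) auto

text \<open>Index shift for differentiated monomials; the summand 0 stands for the monomials that do
  not contain the variable.\<close>

lemma sum_degree_Suc:
  fixes f :: "nat \<Rightarrow> nat \<Rightarrow> nat \<Rightarrow> complex"
  shows "(\<Sum>(i, j, k) \<in> {(i, j, k). i + j + k = Suc m}. if i = 0 then 0 else f (i - 1) j k) =
      (\<Sum>(i, j, k) \<in> {(i, j, k). i + j + k = m}. f i j k)" (is ?A)
    and "(\<Sum>(i, j, k) \<in> {(i, j, k). i + j + k = Suc m}. if j = 0 then 0 else f i (j - 1) k) =
      (\<Sum>(i, j, k) \<in> {(i, j, k). i + j + k = m}. f i j k)" (is ?B)
    and "(\<Sum>(i, j, k) \<in> {(i, j, k). i + j + k = Suc m}. if k = 0 then 0 else f i j (k - 1)) =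
      (\<Sum>(i, j, k) \<in> {(i, j, k). i + j + k = m}. f i j k)" (is ?C)
proof -
  show ?A
    by (rule trans[OF sum.mono_neutral_right[where S = "{(i, j, k). i + j + k = Suc m \<and> i \<noteq> 0}"]
          sum.reindex_bij_witness[where i = "\<lambda>(i, j, k). (Suc i, j, k)" and j = "\<lambda>(i, j, k). (i - 1, j, k)"]]) (auto split: if_splits)
  show ?B
    by (rule trans[OF sum.mono_neutral_right[where S = "{(i, j, k). i + j + k = Suc m \<and> j \<noteq> 0}"]
          sum.reindex_bij_witness[where i = "\<lambda>(i, j, k). (i, Suc j, k)" and j = "\<lambda>(i, j, k). (i, j - 1, k)"]]) (auto split: if_splits)
  show ?C
    by (rule trans[OF sum.mono_neutral_right[where S = "{(i, j, k). i + j + k = Suc m \<and> k \<noteq> 0}"]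
          sum.reindex_bij_witness[where i = "\<lambda>(i, j, k). (i, j, Suc k)" and j = "\<lambda>(i, j, k). (i, j, k - 1)"]]) (auto split: if_splits)
qed

lemma of_nat_mult_div_fact:
  "of_nat i * (x / fact i) = (if i = 0 then 0 else x / fact (i - 1) :: complex)"
  by (cases i) (auto simp: field_simps simp del: of_nat_Suc)

text \<open>The right side is the derivative along \<open>w\<close> of the form of degree
  \<open>Suc m\<close>, in the shape that the product rule gives. Taking \<open>w = v\<close> leads
  to Euler's identity.\<close>

lemma sym_form_shift: "sym_form m (shift w u) v =
   (\<Sum>(i, j, k) \<in> {(i, j, k). i + j + k = Suc m}. u i j k *
      (w $ 1 * (of_nat i * (v $ 1 ^ (i - 1) / fact i)) * (v $ 2 ^ j / fact j) * (v $ 3 ^ k / fact k) +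
       w $ 2 * (v $ 1 ^ i / fact i) * (of_nat j * (v $ 2 ^ (j - 1) / fact j)) * (v $ 3 ^ k / fact k) +
       w $ 3 * (v $ 1 ^ i / fact i) * (v $ 2 ^ j / fact j) * (of_nat k * (v $ 3 ^ (k - 1) / fact k))))"
  (is "_ = ?R")
proof -
  let ?t = "\<lambda>i j k. (v $ 1 ^ i / fact i) * (v $ 2 ^ j / fact j) * (v $ 3 ^ k / fact k)"
  let ?S = "\<lambda>m. {(i, j, k). i + j + k = (m::nat)}"
  have "?R = (\<Sum>(i, j, k) \<in> ?S (Suc m).
      (if i = 0 then 0 else w $ 1 * u (Suc (i-1)) j k * ?t (i-1) j k) +
      (if j = 0 then 0 else w $ 2 * u i (Suc (j-1)) k * ?t i (j-1) k) +
      (if k = 0 then 0 else w $ 3 * u i j (Suc (k-1)) * ?t i j (k-1)))"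
    unfolding of_nat_mult_div_fact
    by (intro sum.cong refl) (clarsimp simp: algebra_simps)
  also have "\<dots> =
      (\<Sum>(i, j, k) \<in> ?S (Suc m). if i = 0 then 0 else w $ 1 * u (Suc (i-1)) j k * ?t (i-1) j k) +
      (\<Sum>(i, j, k) \<in> ?S (Suc m). if j = 0 then 0 else w $ 2 * u i (Suc (j-1)) k * ?t i (j-1) k) +
      (\<Sum>(i, j, k) \<in> ?S (Suc m). if k = 0 then 0 else w $ 3 * u i j (Suc (k-1)) * ?t i j (k-1))"
    by (simp add: sum.distrib case_prod_unfold)
  also have "\<dots> =
      (\<Sum>(i, j, k) \<in> ?S m. w $ 1 * u (Suc i) j k * ?t i j k) +
      (\<Sum>(i, j, k) \<in> ?S m. w $ 2 * u i (Suc j) k * ?t i j k) +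
      (\<Sum>(i, j, k) \<in> ?S m. w $ 3 * u i j (Suc k) * ?t i j k)"
    using sum_degree_Suc(1)[where m = m and f = "\<lambda>i j k. w $ 1 * u (Suc i) j k * ?t i j k"]
      sum_degree_Suc(2)[where m = m and f = "\<lambda>i j k. w $ 2 * u i (Suc j) k * ?t i j k"]
      sum_degree_Suc(3)[where m = m and f = "\<lambda>i j k. w $ 3 * u i j (Suc k) * ?t i j k"]
    by presburger
  also have "\<dots> = sym_form m (shift w u) v"
    unfolding sum.distrib[symmetric] sym_form_def shift_def
    by (intro sum.cong) (auto simp: algebra_simps)
  finally show ?thesis by simp
qed

text \<open>Euler's identity for a homogeneous form. Since \<open>of_nat (Suc m)\<close> is nonzero,
  it recovers the form of degree \<open>Suc m\<close> from one of degree \<open>m\<close> and so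
  carries inductions on the degree.\<close>

lemma sym_form_Suc: "of_nat (Suc m) * sym_form (Suc m) u v = sym_form m (shift v u) v"
proof -
  have p: "x * (of_nat i * (x ^ (i - 1) / fact i)) = of_nat i * (x ^ i / fact i)" for x :: complex and i
    by (cases i) simp_all
  have "of_nat (i + j + k) * (u * (x ^ i / fact i) * (y ^ j / fact j) * (z ^ k / fact k)) =
    u * (x * (of_nat i * (x ^ (i - 1) / fact i)) * (y ^ j / fact j) * (z ^ k / fact k) +
      y * (x ^ i / fact i) * (of_nat j * (y ^ (j - 1) / fact j)) * (z ^ k / fact k) +
      z * (x ^ i / fact i) * (y ^ j / fact j) * (of_nat k * (z ^ (k - 1) / fact k)))"
    for u x y z :: complex and i j k
    using p[of x i] p[of y j] p[of z k] unfolding of_nat_add by algebra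
  note eq = this
  show ?thesis
    unfolding sym_form_shift unfolding sym_form_def sum_distrib_left
  proof (intro sum.cong refl)
    fix x :: "nat \<times> nat \<times> nat" assume "x \<in> {(i, j, k). i + j + k = Suc m}"
    then obtain i j k where x: "x = (i, j, k)" and m: "Suc m = i + j + k" by auto
    show "of_nat (Suc m) * (case x of (i, j, k) \<Rightarrow> u i j k * (v $ 1 ^ i / fact i) *
        (v $ 2 ^ j / fact j) * (v $ 3 ^ k / fact k)) = (case x of (i, j, k) \<Rightarrow> u i j k *
      (v $ 1 * (of_nat i * (v $ 1 ^ (i - 1) / fact i)) * (v $ 2 ^ j / fact j) * (v $ 3 ^ k / fact k) +
       v $ 2 * (v $ 1 ^ i / fact i) * (of_nat j * (v $ 2 ^ (j - 1) / fact j)) * (v $ 3 ^ k / fact k) +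
       v $ 3 * (v $ 1 ^ i / fact i) * (v $ 2 ^ j / fact j) * (of_nat k * (v $ 3 ^ (k - 1) / fact k))))"
      unfolding x m prod.case by (rule eq)
  qed
qed

lemma sym_form_0 [simp]: "sym_form 0 u v = u 0 0 0"
proof -
  have "{(i, j, k). i + j + k = (0::nat)} = {(0, 0, 0)}" by auto
  thus ?thesis by (simp add: sym_form_def)
qed

lemma sym_form_cong:
  "(\<And>a b c. a + b + c = m \<Longrightarrow> u a b c = w a b c) \<Longrightarrow> sym_form m u v = sym_form m w v"
  unfolding sym_form_def by (intro sum.cong) auto

lemma sym_form_lincomb:
  "sym_form m (\<lambda>a b c. x * f a b c + y * g a b c) v = x * sym_form m f v + y * sym_form m g v"
  unfolding sym_form_def sum_distrib_left sum.distrib[symmetric]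
  by (intro sum.cong) (auto simp: algebra_simps)

text \<open>Euler's identity leads from degree \<open>Suc m\<close> to
  \<open>shift v (pull M u)\<close> in degree \<open>m\<close>, and the chain rule rewrites this as
  the pullback of \<open>shift (M *v v) u\<close>, to which the induction hypothesis
  applies.\<close>

lemma sym_form_pull: "sym_form m (pull M u) v = sym_form m u (M *v v)"
proof (induction m arbitrary: u)
  case (Suc m)
  have "of_nat (Suc m) * sym_form (Suc m) (pull M u) v = of_nat (Suc m) * sym_form (Suc m) u (M *v v)"
    unfolding sym_form_Suc shift_pull Suc ..
  thus ?case by (simp del: of_nat_Suc)
qed simp

section \<open>Derivatives of forms and of Taylor polynomials\<close>

lemma deriv_sym_form:
  "((\<lambda>t. sym_form (Suc m) u (v + t *s w)) has_field_derivative sym_form m (shift w u) v) (at 0)"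
proof -
  have d: "((\<lambda>t. (x + t * y) ^ i / fact i) has_field_derivative
      y * (of_nat i * (x ^ (i - 1) / fact i))) (at 0)" for x y :: complex and i
    by (auto intro!: derivative_eq_intros)
  show ?thesis
    unfolding sym_form_shift unfolding sym_form_def
  proof (intro DERIV_sum)
    fix x :: "nat \<times> nat \<times> nat"
    obtain i j k where x: "x = (i, j, k)" by (cases x)
    show "((\<lambda>t. case x of (i, j, k) \<Rightarrow> u i j k * ((v + t *s w) $ 1 ^ i / fact i) *
        ((v + t *s w) $ 2 ^ j / fact j) * ((v + t *s w) $ 3 ^ k / fact k)) has_field_derivative
       (case x of (i, j, k) \<Rightarrow> u i j k *
      (w $ 1 * (of_nat i * (v $ 1 ^ (i - 1) / fact i)) * (v $ 2 ^ j / fact j) * (v $ 3 ^ k / fact k) +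
       w $ 2 * (v $ 1 ^ i / fact i) * (of_nat j * (v $ 2 ^ (j - 1) / fact j)) * (v $ 3 ^ k / fact k) +
       w $ 3 * (v $ 1 ^ i / fact i) * (v $ 2 ^ j / fact j) * (of_nat k * (v $ 3 ^ (k - 1) / fact k))))) (at 0)"
      unfolding x prod.case vector_add_component vector_smult_component
      by (rule derivative_eq_intros d refl)+ (simp add: algebra_simps)
  qed
qed

lemma shift_axis [simp]:
  "shift (axis 1 1) u = (\<lambda>a b c. u (Suc a) b c)"
  "shift (axis 2 1) u = (\<lambda>a b c. u a (Suc b) c)"
  "shift (axis 3 1) u = (\<lambda>a b c. u a b (Suc c))"
  by (simp_all add: shift_def axis_def)

lemma partial_taylor_Suc:
  "partial i (taylor (Suc k) (p, u)) = taylor k (p, shift (axis i 1) u)"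
proof
  fix q
  have "taylor (Suc k) (p, u) (q + t *s axis i 1) =
      u 0 0 0 + (\<Sum>m\<le>k. sym_form (Suc m) u ((q - p) + t *s axis i 1))" for t
    unfolding taylor_def sum.atMost_Suc_shift by (simp add: algebra_simps)
  moreover have "((\<lambda>t. u 0 0 0 + (\<Sum>m\<le>k. sym_form (Suc m) u ((q - p) + t *s axis i 1)))
      has_field_derivative 0 + (\<Sum>m\<le>k. sym_form m (shift (axis i 1) u) (q - p))) (at 0)"
    by (intro DERIV_add DERIV_const DERIV_sum deriv_sym_form)
  ultimately show "partial i (taylor (Suc k) (p, u)) q = taylor k (p, shift (axis i 1) u) q"
    by (simp add: partial_def taylor_def DERIV_imp_deriv)
qed

lemma partials_taylor:
  assumes "a + b + c \<le> k"
  shows "partials a b c (taylor k (p, u)) =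
    taylor (k - (a + b + c)) (p, \<lambda>i j l. u (a + i) (b + j) (c + l))"
proof -
  have step: "m \<le> k \<Longrightarrow> (partial i ^^ m) (taylor k (p, u)) =
      taylor (k - m) (p, (shift (axis i 1) ^^ m) u)" for i m k u
  proof (induction m)
    case (Suc m)
    hence "k - m = Suc (k - Suc m)" by simp
    thus ?case using Suc by (simp add: partial_taylor_Suc)
  qed simp
  have 1: "(shift (axis 1 1) ^^ m) u = (\<lambda>i j l. u (m + i) j l)" for m u by (induction m) auto
  have 2: "(shift (axis 2 1) ^^ m) u = (\<lambda>i j l. u i (m + j) l)" for m u by (induction m) auto
  have 3: "(shift (axis 3 1) ^^ m) u = (\<lambda>i j l. u i j (m + l))" for m u by (induction m) auto
  show ?thesis using assms by (simp add: partials_def step 1 2 3 algebra_simps)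
qed

lemma sym_form_at_0: "sym_form (Suc m) u 0 = 0"
  using sym_form_Suc[of m u 0] sym_form_lincomb[of m 0 u 0 u]
  by (simp add: shift_def del: of_nat_Suc)

lemma taylor_at_base [simp]: "taylor k (p, u) p = u 0 0 0"
  by (cases k) (simp_all add: taylor_def sum.atMost_Suc_shift sym_form_at_0 del: sum.atMost_Suc)

lemma partials_taylor_at_base: "a + b + c \<le> k \<Longrightarrow> partials a b c (taylor k (p, u)) p = u a b c"
  by (simp add: partials_taylor)

lemma jet_of_taylor: "jet_of k (taylor k \<theta>) (fst \<theta>) = truncate k \<theta>"
  by (cases \<theta>) (auto simp: jet_of_def truncate_def partials_taylor_at_base fun_eq_iff)

text \<open>A form is the Taylor polynomial at 0 of the family cut down to degree \<open>m\<close>,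
  so its partial derivatives at 0 recover the coefficients.\<close>

lemma sym_form_unique:
  assumes "\<And>v. sym_form m u v = sym_form m w v" "a + b + c = m"
  shows "u a b c = w a b c"
proof -
  have T: "taylor m (0, \<lambda>a b c. if a + b + c = m then u a b c else 0) = sym_form m u" for u
  proof
    fix v
    have "sym_form l (\<lambda>a b c. if a + b + c = m then u a b c else 0) v =
        (if l = m then sym_form m u v else 0)" for l
    proof (cases "l = m")
      case False
      hence "sym_form l (\<lambda>a b c. if a + b + c = m then u a b c else 0) v = sym_form l (\<lambda>a b c. 0) v"
        by (intro sym_form_cong) auto
      thus ?thesis using False by (simp add: sym_form_def)
    qed (auto intro: sym_form_cong)
    thus "taylor m (0, \<lambda>a b c. if a + b + c = m then u a b c else 0) v = sym_form m u v"
      by (simp add: taylor_def)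
  qed
  have "sym_form m u = sym_form m w" using assms(1) by auto
  hence "partials a b c (taylor m (0, \<lambda>a b c. if a + b + c = m then u a b c else 0)) 0 =
      partials a b c (taylor m (0, \<lambda>a b c. if a + b + c = m then w a b c else 0)) 0"
    by (simp only: T)
  thus ?thesis using assms(2) by (simp add: partials_taylor_at_base)
qed

text \<open>A linear substitution preserves degrees of forms, so the derivatives of f o M of order
  \<open>m\<close> depend only on those of f of order \<open>m\<close>. This makes
  \<open>pull\<close> compatible with truncation.\<close>

lemma pull_cong_degree:
  assumes "\<And>a b c. a + b + c = m \<Longrightarrow> u a b c = w a b c" "a + b + c = m"
  shows "pull M u a b c = pull M w a b c"
proof (rule sym_form_unique[OF _ assms(2)])
  show "sym_form m (pull M u) v = sym_form m (pull M w) v" for v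
    unfolding sym_form_pull by (rule sym_form_cong) (rule assms(1))
qed

lemma pull_degree_zero:
  assumes "\<And>a b c. a + b + c = m \<Longrightarrow> u a b c = 0" "a + b + c = m"
  shows "pull M u a b c = 0"
  using pull_cong_degree[of m u "\<lambda>a b c. 0 * u a b c" a b c M] assms pull_scale[of M 0 u]
  by simp

lemma pull_pull: "pull M' (pull M u) = pull (M ** M') u"
  by ((rule ext)+, rule sym_form_unique[OF _ refl]) (simp add: sym_form_pull matrix_vector_mul_assoc)

lemma pull_mat_1 [simp]: "pull (mat 1) u = u"
  by ((rule ext)+, rule sym_form_unique[OF _ refl]) (simp add: sym_form_pull)

section \<open>Prolonged linear maps and the Euler equation in coordinates\<close>

lemma prolong_eq:
  assumes "M ** B = mat 1" "B ** M = mat 1"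
  shows "prolong k B \<theta> = truncate k (B *v fst \<theta>, pull M (snd \<theta>))"
proof -
  have inv: "matrix_inv B = M"
  proof -
    \<comment> \<open>\<open>matrix_inv\<close> chooses some two-sided inverse, which uniqueness of
      inverses identifies with \<open>M\<close>.\<close>
    have "B ** matrix_inv B = mat 1 \<and> matrix_inv B ** B = mat 1"
      unfolding matrix_inv_def by (rule someI[of _ M]) (simp add: assms)
    thus ?thesis
      by (metis assms(1) matrix_mul_assoc matrix_mul_lid matrix_mul_rid)
  qed
  have "M *v (B *v v) = v" for v
    by (simp add: matrix_vector_mul_assoc assms)
  \<comment> \<open>With p the base point, M q - p = M (q - B p), so the composite is again a Taylor
    polynomial, now based at B p.\<close>
  hence "(\<lambda>q. taylor k \<theta> (M *v q)) = taylor k (B *v fst \<theta>, pull M (snd \<theta>))"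
    by (simp add: fun_eq_iff taylor_def sym_form_pull matrix_vector_mult_diff_distrib)
  thus ?thesis
    using jet_of_taylor[of k "(B *v fst \<theta>, pull M (snd \<theta>))"] by (simp add: prolong_def inv)
qed

text \<open>
  Total derivatives of the Euler equation are computed on the Taylor polynomial by writing
  $q = p + (q - p)$ and using Euler's identity for the forms $\Theta_m$.
\<close>

lemma total_deriv_euler:
  "total_deriv 1 a b c (euler n) (p, u) =
     shift p u a b c - (of_nat n - of_nat (a + b + c)) * u a b c"
proof -
  define m where "m = a + b + c"
  \<comment> \<open>\<open>w\<close> lists the derivatives of the Euler expression evaluated on the
    Taylor polynomial. First derivatives of a Taylor polynomial of order \<open>Suc m\<close> have
    order \<open>m\<close>, hence the cut-off in the first summand.\<close>
  define w where "w = (\<lambda>a b c. (if a + b + c \<le> m then shift p u a b c else 0) +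
      (of_nat (a + b + c) - of_nat n) * u a b c)"
  have "euler n (jet_of 1 (taylor (Suc m) (p, u)) q) = taylor (Suc m) (p, w) q" for q
  proof -
    let ?T = "\<lambda>i. taylor m (p, shift (axis i 1) u) q"
    have jet: "snd (jet_of 1 (taylor (Suc m) (p, u)) q) 1 0 0 = ?T 1"
      "snd (jet_of 1 (taylor (Suc m) (p, u)) q) 0 1 0 = ?T 2"
      "snd (jet_of 1 (taylor (Suc m) (p, u)) q) 0 0 1 = ?T 3"
      "snd (jet_of 1 (taylor (Suc m) (p, u)) q) 0 0 0 = taylor (Suc m) (p, u) q"
      "fst (jet_of 1 (taylor (Suc m) (p, u)) q) = q"
      by (simp_all add: jet_of_def partials_def partial_taylor_Suc)
    have lin: "sym_form l (shift v u) x = v $ 1 * sym_form l (shift (axis 1 1) u) x +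
        v $ 2 * sym_form l (shift (axis 2 1) u) x + v $ 3 * sym_form l (shift (axis 3 1) u) x" for l v x
      unfolding shift_def[of v] shift_axis
      using sym_form_lincomb[of l 1 "\<lambda>a b c. v $ 1 * u (Suc a) b c + v $ 2 * u a (Suc b) c" "v $ 3"
          "\<lambda>a b c. u a b (Suc c)"]
        sym_form_lincomb[of l "v $ 1" "\<lambda>a b c. u (Suc a) b c" "v $ 2" "\<lambda>a b c. u a (Suc b) c"]
      by simp
    have 1: "(\<Sum>l\<le>m. sym_form l (shift (q - p) u) (q - p)) =
        (\<Sum>l\<le>Suc m. of_nat l * sym_form l u (q - p))"
      by (subst sum.atMost_Suc_shift) (simp add: sym_form_Suc del: of_nat_Suc)
    have W: "sym_form l w x = (if l \<le> m then sym_form l (shift p u) x else 0) +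
        (of_nat l - of_nat n) * sym_form l u x" for l x
    proof (cases "l \<le> m")
      case True
      hence "sym_form l w x =
          sym_form l (\<lambda>a b c. 1 * shift p u a b c + (of_nat l - of_nat n) * u a b c) x"
        by (intro sym_form_cong) (simp add: w_def del: of_nat_add)
      thus ?thesis using True by (simp only: sym_form_lincomb) simp
    next
      case False
      hence "sym_form l w x =
          sym_form l (\<lambda>a b c. 0 * u a b c + (of_nat l - of_nat n) * u a b c) x"
        by (intro sym_form_cong) (simp add: w_def del: of_nat_add)
      thus ?thesis using False by (simp only: sym_form_lincomb) simp
    qed
    have A: "q $ 1 * ?T 1 + q $ 2 * ?T 2 + q $ 3 * ?T 3 =
        (\<Sum>l\<le>m. sym_form l (shift p u) (q - p)) + (\<Sum>l\<le>m. sym_form l (shift (q - p) u) (q - p))"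
      unfolding taylor_def sum_distrib_left sum.distrib[symmetric] lin[of _ p] lin[of _ "q - p"]
      by (intro sum.cong refl) (simp add: algebra_simps)
    have B: "taylor (Suc m) (p, w) q = (\<Sum>l\<le>m. sym_form l (shift p u) (q - p)) +
        (\<Sum>l\<le>Suc m. of_nat l * sym_form l u (q - p)) - of_nat n * taylor (Suc m) (p, u) q"
      unfolding taylor_def snd_conv fst_conv W
      by (simp add: sum.distrib sum_distrib_left sum_subtractf algebra_simps)
    show ?thesis
      unfolding euler_def jet A B 1 ..
  qed
  hence "total_deriv 1 a b c (euler n) (p, u) = partials a b c (taylor (Suc m) (p, w)) p"
    unfolding total_deriv_def by (simp add: m_def)
  also have "\<dots> = w a b c"
    by (rule partials_taylor_at_base) (simp add: m_def)
  finally show ?thesis by (simp add: w_def m_def algebra_simps)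
qed

text \<open>The prolonged equation says that derivatives of order m are homogeneous of degree n - m,
  a number that may be negative and is therefore formed in the complex numbers.\<close>

lemma regular_part_iff:
  "(p, u) \<in> regular_part n k \<longleftrightarrow> p \<noteq> 0 \<and> (\<forall>a b c. k < a + b + c \<longrightarrow> u a b c = 0) \<and>
     (\<forall>a b c. a + b + c < k \<longrightarrow> shift p u a b c = (of_nat n - of_nat (a + b + c)) * u a b c)"
  unfolding regular_part_def euler_eq_def jet_space_def mem_Collect_eq total_deriv_euler by auto

text \<open>The Euler field commutes with every linear map, so the determinant is left free; the
  changes of base point below may have determinant other than 1.\<close>

lemma regular_part_pull:
  assumes "(p, u) \<in> regular_part n k" "M ** B = mat 1"
  shows "(B *v p, pull M u) \<in> regular_part n k"
proof -
  have Mp: "M *v (B *v p) = p"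
    by (simp add: matrix_vector_mul_assoc assms)
  have "B *v p \<noteq> 0"
    using Mp assms(1) by (auto simp: regular_part_iff)
  moreover have "pull M u a b c = 0" if "k < a + b + c" for a b c
    using assms(1) that by (intro pull_degree_zero[OF _ refl]) (auto simp: regular_part_iff)
  moreover have "shift (B *v p) (pull M u) a b c = (of_nat n - of_nat (a + b + c)) * pull M u a b c"
    if "a + b + c < k" for a b c
  proof -
    have "pull M (shift p u) a b c =
        pull M (\<lambda>i j l. (of_nat n - of_nat (a + b + c)) * u i j l) a b c"
      using assms(1) that by (intro pull_cong_degree[OF _ refl]) (auto simp: regular_part_iff simp del: of_nat_add)
    thus ?thesis by (simp add: shift_pull Mp pull_scale del: of_nat_add)
  qed
  ultimately show ?thesis by (simp add: regular_part_iff)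
qed

lemma truncate_regular_part [simp]: "\<theta> \<in> regular_part n k \<Longrightarrow> truncate k \<theta> = \<theta>"
  by (cases \<theta>) (auto simp: regular_part_iff truncate_def fun_eq_iff not_le)

lemma truncate_pull: "truncate k (p, pull M (snd (truncate k (q, u)))) = truncate k (p, pull M u)"
proof -
  have "pull M (snd (truncate k (q, u))) a b c = pull M u a b c" if "a + b + c \<le> k" for a b c
    by (rule pull_cong_degree[OF _ refl]) (use that in \<open>simp add: truncate_def\<close>)
  thus ?thesis by (simp add: truncate_def fun_eq_iff)
qed

lemma truncate_mem_regular_part:
  "\<theta> \<in> regular_part n l \<Longrightarrow> k \<le> l \<Longrightarrow> truncate k \<theta> \<in> regular_part n k"
  by (cases \<theta>) (auto simp: regular_part_iff truncate_def shift_def)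

subsection \<open>Fractions with a fixed denominator\<close>

text \<open>Localisation of the algebra at \<open>w\<close>, over the set \<open>X\<close>. A common
  denominator up to powers gives closure under sums, products and division by \<open>w\<close>. With
  \<open>w\<close> constantly 1 and \<open>X\<close> everything, the same closure lemmas serve for
  polynomials.\<close>

definition frac_in :: "('a \<Rightarrow> complex) set \<Rightarrow> ('a \<Rightarrow> complex) \<Rightarrow> 'a set \<Rightarrow> ('a \<Rightarrow> complex) \<Rightarrow> bool" where
  "frac_in G w X f \<longleftrightarrow> (\<exists>N. \<exists>h \<in> algebra_gen G. \<forall>x\<in>X. f x * w x ^ N = h x)"

lemma frac_inI:
  "h \<in> algebra_gen G \<Longrightarrow> (\<And>x. x \<in> X \<Longrightarrow> f x * w x ^ N = h x) \<Longrightarrow> frac_in G w X f"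
  unfolding frac_in_def by blast

lemma algebra_gen_power: "f \<in> algebra_gen G \<Longrightarrow> (\<lambda>x. f x ^ m) \<in> algebra_gen G"
  by (induction m) (auto intro: algebra_gen.intros)

lemma algebra_gen_minus: "f \<in> algebra_gen G \<Longrightarrow> (\<lambda>x. - f x) \<in> algebra_gen G"
  using algebra_gen.mult[OF algebra_gen.const[of "-1"], of f G] by simp

lemma algebra_gen_diff:
  "f \<in> algebra_gen G \<Longrightarrow> g \<in> algebra_gen G \<Longrightarrow> (\<lambda>x. f x - g x) \<in> algebra_gen G"
  using algebra_gen.add[OF _ algebra_gen_minus, of f G g] by simp

lemmas algebra_gen_intros = algebra_gen.const algebra_gen.add algebra_gen.mult
  algebra_gen_power algebra_gen_minus algebra_gen_diff

lemma algebra_gen_mono: "f \<in> algebra_gen G \<Longrightarrow> G \<subseteq> G' \<Longrightarrow> f \<in> algebra_gen G'"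
  by (induction rule: algebra_gen.induct) (auto intro: algebra_gen.intros)

lemma frac_in_algebra_gen: "f \<in> algebra_gen G \<Longrightarrow> frac_in G w X f"
  unfolding frac_in_def by (rule exI[of _ 0]) auto

lemma frac_in_const: "frac_in G w X (\<lambda>_. c)"
  by (intro frac_in_algebra_gen algebra_gen.const)

lemma frac_in_cong: "(\<And>x. x \<in> X \<Longrightarrow> f x = g x) \<Longrightarrow> frac_in G w X f \<longleftrightarrow> frac_in G w X g"
  by (simp add: frac_in_def)

lemma frac_in_UNIV_1 [simp]: "frac_in G (\<lambda>_. 1) UNIV f \<longleftrightarrow> f \<in> algebra_gen G"
proof
  assume "frac_in G (\<lambda>_. 1) UNIV f"
  then obtain h where "h \<in> algebra_gen G" "\<And>x. f x = h x" by (auto simp: frac_in_def)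
  thus "f \<in> algebra_gen G" by (metis ext)
qed (rule frac_in_algebra_gen)

context
  fixes G :: "('a \<Rightarrow> complex) set" and w :: "'a \<Rightarrow> complex" and X :: "'a set"
  assumes w: "w \<in> algebra_gen G"
begin

lemma frac_in_add:
  assumes "frac_in G w X f" "frac_in G w X g"
  shows "frac_in G w X (\<lambda>x. f x + g x)"
proof -
  from assms obtain N N' h h' where h: "h \<in> algebra_gen G" "h' \<in> algebra_gen G"
    and "\<And>x. x \<in> X \<Longrightarrow> f x * w x ^ N = h x" "\<And>x. x \<in> X \<Longrightarrow> g x * w x ^ N' = h' x"
    unfolding frac_in_def by blast
  hence *: "(f x + g x) * w x ^ (N + N') = h x * w x ^ N' + h' x * w x ^ N" if "x \<in> X" for x
    using that by (simp add: power_add algebra_simps flip: \<open>\<And>x. x \<in> X \<Longrightarrow> f x * w x ^ N = h x\<close>)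
  have "(\<lambda>x. h x * w x ^ N' + h' x * w x ^ N) \<in> algebra_gen G"
    by (intro algebra_gen_intros h w)
  thus ?thesis using * by (rule frac_inI)
qed

lemma frac_in_mult:
  assumes "frac_in G w X f" "frac_in G w X g"
  shows "frac_in G w X (\<lambda>x. f x * g x)"
proof -
  from assms obtain N N' h h' where h: "h \<in> algebra_gen G" "h' \<in> algebra_gen G"
    and "\<And>x. x \<in> X \<Longrightarrow> f x * w x ^ N = h x" "\<And>x. x \<in> X \<Longrightarrow> g x * w x ^ N' = h' x"
    unfolding frac_in_def by blast
  hence *: "(f x * g x) * w x ^ (N + N') = h x * h' x" if "x \<in> X" for x
    using that by (simp add: power_add algebra_simps flip: \<open>\<And>x. x \<in> X \<Longrightarrow> f x * w x ^ N = h x\<close>)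
  have "(\<lambda>x. h x * h' x) \<in> algebra_gen G"
    by (intro algebra_gen_intros h)
  thus ?thesis using * by (rule frac_inI)
qed

lemma frac_in_divide:
  assumes "frac_in G w X f" "\<And>x. x \<in> X \<Longrightarrow> w x \<noteq> 0"
  shows "frac_in G w X (\<lambda>x. f x / w x)"
proof -
  from assms(1) obtain N h where h: "h \<in> algebra_gen G" "\<And>x. x \<in> X \<Longrightarrow> f x * w x ^ N = h x"
    unfolding frac_in_def by blast
  hence *: "f x / w x * w x ^ Suc N = h x" if "x \<in> X" for x
    using that assms(2) by simp
  with h(1) show ?thesis by (rule frac_inI)
qed

lemma frac_in_compose:
  assumes "P \<in> algebra_gen C" "\<And>c. c \<in> C \<Longrightarrow> frac_in G w X (\<lambda>x. c (\<phi> x))"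
  shows "frac_in G w X (\<lambda>x. P (\<phi> x))"
  using assms(1)
  by induction (auto intro: frac_in_const frac_in_add frac_in_mult assms(2))

lemma frac_in_shift:
  assumes "\<And>i. frac_in G w X (\<lambda>x. v x $ i)"
    and "\<And>a b c. a + b + c = Suc m \<Longrightarrow> frac_in G w X (\<lambda>x. U x a b c)" "a + b + c = m"
  shows "frac_in G w X (\<lambda>x. shift (v x) (U x) a b c)"
  unfolding shift_def using assms(3) by (intro frac_in_add frac_in_mult assms) auto

lemma frac_in_shift_funpow:
  assumes "\<And>i. frac_in G w X (\<lambda>x. v x $ i)"
    and "\<And>a b c. a + b + c = l + m \<Longrightarrow> frac_in G w X (\<lambda>x. U x a b c)" "a + b + c = m"
  shows "frac_in G w X (\<lambda>x. (shift (v x) ^^ l) (U x) a b c)"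
  using assms(2,3)
proof (induction l arbitrary: m a b c)
  case (Suc l)
  have "frac_in G w X (\<lambda>x. (shift (v x) ^^ l) (U x) i j k)" if "i + j + k = Suc m" for i j k
    using Suc.IH[of "Suc m" i j k] Suc.prems(1) that by simp
  thus ?case using frac_in_shift[OF assms(1), of m "\<lambda>x. (shift (v x) ^^ l) (U x)"] Suc.prems(2) by simp
qed auto

text \<open>Assuming rationality only in the exact order \<open>a + b + c\<close> ensures that
  pulling back never calls for generators of higher order.\<close>

lemma frac_in_pull:
  assumes M: "\<And>i j. frac_in G w X (\<lambda>x. M x $ i $ j)"
    and u: "\<And>i j l. i + j + l = a + b + c \<Longrightarrow> frac_in G w X (\<lambda>x. u x i j l)"
  shows "frac_in G w X (\<lambda>x. pull (M x) (u x) a b c)"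
proof -
  have col: "frac_in G w X (\<lambda>x. column j (M x) $ i)" for i j
    by (simp add: column_def M)
  have 3: "frac_in G w X (\<lambda>x. (shift (column 3 (M x)) ^^ c) (u x) i j l)"
    if "i + j + l = a + b" for i j l
    by (rule frac_in_shift_funpow[OF col _ that]) (simp add: u algebra_simps)
  have 2: "frac_in G w X (\<lambda>x. (shift (column 2 (M x)) ^^ b) ((shift (column 3 (M x)) ^^ c) (u x)) i j l)"
    if "i + j + l = a" for i j l
    by (rule frac_in_shift_funpow[OF col _ that]) (simp add: 3 algebra_simps)
  show ?thesis
    unfolding pull_def by (rule frac_in_shift_funpow[OF col, where m = 0]) (simp_all add: 2)
qed

end

lemma algebra_gen_univariate:
  "f \<in> algebra_gen {\<lambda>t. t} \<Longrightarrow> \<exists>p. \<forall>t. f t = poly p t"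
proof (induction rule: algebra_gen.induct)
  case (const c)
  show ?case by (rule exI[of _ "[:c:]"]) simp
next
  case (gen g)
  thus ?case by (intro exI[of _ "[:0, 1:]"]) auto
qed (metis poly_add, metis poly_mult)

lemma algebra_gen_univariate_common:
  assumes "finite F" "\<And>f. f \<in> F \<Longrightarrow> f \<in> algebra_gen {\<lambda>t. t} \<and> (\<exists>t. f t \<noteq> 0)"
  shows "\<exists>t. \<forall>f\<in>F. f t \<noteq> 0"
proof -
  have "finite {t. f t = 0}" if "f \<in> F" for f
  proof -
    from assms(2)[OF that] obtain p where p: "\<And>t. f t = poly p t" and "p \<noteq> 0"
      using algebra_gen_univariate by (metis poly_0)
    thus ?thesis by (simp add: poly_roots_finite)
  qed
  hence "finite (\<Union>f\<in>F. {t. f t = 0})" using assms(1) by blast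
  moreover have "infinite (UNIV :: complex set)" by (rule infinite_UNIV_char_0)
  ultimately have "(\<Union>f\<in>F. {t. f t = 0}) \<noteq> UNIV" by metis
  thus ?thesis by blast
qed

subsection \<open>Transvections and irreducibility\<close>

definition pairing :: "complex^3 \<Rightarrow> complex^3 \<Rightarrow> complex" where
  "pairing f v = f $ 1 * v $ 1 + f $ 2 * v $ 2 + f $ 3 * v $ 3"

text \<open>The map v -> v + s f(v) q, of determinant 1 + s f(q); it is a transvection in the strict
  sense if f(q) = 0. For fixed q and f the family is closed under products.\<close>

definition transvection :: "complex^3 \<Rightarrow> complex^3 \<Rightarrow> complex \<Rightarrow> complex^3^3" where
  "transvection q f s = (\<chi> i j. (if i = j then 1 else 0) + s * q $ i * f $ j)"

lemma transvection_mult: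
  "transvection q f s ** transvection q f r = transvection q f (s + r + s * r * pairing f q)"
  by (simp add: transvection_def matrix_matrix_mult_def vec_eq_iff forall_3 sum_3 pairing_def algebra_simps)

lemma transvection_vec: "transvection q f s *v v = v + (s * pairing f v) *s q"
  by (simp add: transvection_def matrix_vector_mult_def vec_eq_iff forall_3 sum_3 pairing_def algebra_simps)

lemma transvection_0 [simp]: "transvection q f 0 = mat 1"
  by (simp add: transvection_def mat_def vec_eq_iff)

text \<open>The parameter r = -t / (1 + t f(q)) solves t + r + t r f(q) = 0, the condition that
  \<open>transvection_mult\<close> imposes.\<close>

lemma transvection_inverse:
  assumes "1 + t * pairing f q \<noteq> 0"
  shows "transvection q f t ** transvection q f (- t / (1 + t * pairing f q)) = mat 1"
    and "transvection q f (- t / (1 + t * pairing f q)) ** transvection q f t = mat 1"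
proof -
  have "t + - t / (1 + t * pairing f q) + t * (- t / (1 + t * pairing f q)) * pairing f q = 0"
    "- t / (1 + t * pairing f q) + t + - t / (1 + t * pairing f q) * t * pairing f q = 0"
    using assms by (simp_all add: divide_simps) algebra+
  thus "transvection q f t ** transvection q f (- t / (1 + t * pairing f q)) = mat 1"
    "transvection q f (- t / (1 + t * pairing f q)) ** transvection q f t = mat 1"
    by (simp_all add: transvection_mult)
qed

lemma common_functional:
  fixes p q :: "complex^3"
  assumes "p \<noteq> 0" "q \<noteq> 0"
  shows "\<exists>f. pairing f p = 1 \<and> pairing f q \<noteq> 0"
proof -
  have axis: "pairing (axis i 1) v = v $ i" for i v
    using exhaust_3[of i] by (auto simp: pairing_def axis_def)
  have add: "pairing (f + g) v = pairing f v + pairing g v" for f g v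
    by (simp add: pairing_def algebra_simps)
  have scale: "pairing (c *s f) v = c * pairing f v" for c f v
    by (simp add: pairing_def algebra_simps)
  from assms obtain i j where i: "p $ i \<noteq> 0" and j: "q $ j \<noteq> 0"
    by (auto simp: vec_eq_iff)
  obtain g where g: "pairing g p \<noteq> 0" "pairing g q \<noteq> 0"
  proof (cases "q $ i = 0"; cases "p $ j = 0")
    \<comment> \<open>Here each coordinate functional kills the other vector, so their sum is
      nonzero on both.\<close>
    assume "q $ i = 0" "p $ j = 0"
    thus ?thesis using that[of "axis i 1 + axis j 1"] i j by (simp add: add axis)
  qed (use that[of "axis i 1"] that[of "axis j 1"] i j in \<open>auto simp: axis\<close>)
  thus ?thesis by (intro exI[of _ "(1 / pairing g p) *s g"]) (simp add: scale)
qed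

text \<open>With f(p) = 1 the map v -> v + f(v) (q - p) takes p to q, and its determinant 1 + f(q -
  p) = f(q) is nonzero.\<close>

lemma move_base_point:
  fixes p q :: "complex^3"
  assumes "p \<noteq> 0" "q \<noteq> 0"
  obtains B M where "B *v p = q" "M *v q = p" "M ** B = mat 1" "B ** M = mat 1"
proof -
  obtain f where f: "pairing f p = 1" "pairing f q \<noteq> 0"
    using common_functional[OF assms] by blast
  define B where "B = transvection (q - p) f 1"
  define M where "M = transvection (q - p) f (- 1 / (1 + 1 * pairing f (q - p)))"
  have "1 + 1 * pairing f (q - p) \<noteq> 0"
    using f by (simp add: pairing_def algebra_simps)
  from transvection_inverse[OF this] have inv: "M ** B = mat 1" "B ** M = mat 1"
    by (simp_all add: B_def M_def)
  have Bp: "B *v p = q" by (simp add: B_def transvection_vec f)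
  hence "M *v q = p" by (metis inv(1) matrix_vector_mul_assoc matrix_vector_mul_lid)
  thus thesis using that Bp inv by blast
qed

lemma regular_part_lincomb:
  assumes "(p, u) \<in> regular_part n k" "(p, w) \<in> regular_part n k"
  shows "(p, \<lambda>a b c. x * u a b c + y * w a b c) \<in> regular_part n k"
  using assms unfolding regular_part_iff shift_lincomb
  by (auto simp: right_diff_distrib distrib_left simp del: of_nat_add)

lemma coordinates_cases:
  assumes "c \<in> coordinates k"
  obtains i where "c = (\<lambda>\<theta>. fst \<theta> $ i)" | a b d where "c = (\<lambda>\<theta>. snd \<theta> a b d)" "a + b + d \<le> k"
  using assms by (auto simp: coordinates_def)

text \<open>
  Two points of the regular part lie on a rational curve in it: the image of a line in one fibre
  under a one-parameter family of transvections.
\<close>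

lemma regular_part_irreducible:
  assumes f: "f \<in> polynomial_functions k" "\<theta>\<^sub>1 \<in> regular_part n k" "f \<theta>\<^sub>1 \<noteq> 0"
    and g: "g \<in> polynomial_functions k" "\<theta>\<^sub>2 \<in> regular_part n k" "g \<theta>\<^sub>2 \<noteq> 0"
  shows "\<exists>\<theta>\<in>regular_part n k. f \<theta> \<noteq> 0 \<and> g \<theta> \<noteq> 0"
proof -
  obtain p\<^sub>1 u\<^sub>1 p\<^sub>2 u\<^sub>2 where \<theta>: "\<theta>\<^sub>1 = (p\<^sub>1, u\<^sub>1)" "\<theta>\<^sub>2 = (p\<^sub>2, u\<^sub>2)" by (metis surj_pair)
  have "p\<^sub>1 \<noteq> 0" "p\<^sub>2 \<noteq> 0" using f g by (auto simp: \<theta> regular_part_iff)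
  then obtain \<phi> where \<phi>: "pairing \<phi> p\<^sub>1 = 1" "pairing \<phi> p\<^sub>2 \<noteq> 0"
    using common_functional by blast
  define q where "q = p\<^sub>2 - p\<^sub>1"
  define w where "w t = 1 + t * pairing \<phi> q" for t
  define M where "M t = transvection q \<phi> t" for t
  define N where "N t = transvection q \<phi> (- t / w t)" for t
  \<comment> \<open>\<open>w t\<close> is the determinant of \<open>M t\<close>, so \<open>X\<close>
    consists of the parameters at which \<open>M t\<close> is invertible.\<close>
  define X where "X = {t. w t \<noteq> 0}"
  have w1: "w 0 = 1" "w 1 = pairing \<phi> p\<^sub>2"
    using \<phi> by (auto simp: w_def q_def pairing_def algebra_simps)
  have MN: "M t ** N t = mat 1" "N t ** M t = mat 1" if "t \<in> X" for t
    using transvection_inverse[of t \<phi> q] that unfolding M_def N_def w_def X_def by auto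
  have X: "0 \<in> X" "1 \<in> X" using w1 \<phi> by (auto simp: X_def)
  have Mp: "M t *v p\<^sub>1 = p\<^sub>1 + t *s q" for t by (simp add: M_def transvection_vec \<phi>)
  have "N 1 *v p\<^sub>2 = N 1 *v (M 1 *v p\<^sub>1)" unfolding Mp by (simp add: q_def)
  also have "\<dots> = p\<^sub>1" using MN X by (simp add: matrix_vector_mul_assoc)
  finally have Np: "N 1 *v p\<^sub>2 = p\<^sub>1" .
  \<comment> \<open>The second jet is carried back to the fibre of the first, where the equation is
    linear and contains the line through both.\<close>
  define u\<^sub>3 where "u\<^sub>3 = pull (M 1) u\<^sub>2"
  have u3: "(p\<^sub>1, u\<^sub>3) \<in> regular_part n k"
    using regular_part_pull[of p\<^sub>2 u\<^sub>2 n k "M 1" "N 1"] g MN X Np by (simp add: \<theta> u\<^sub>3_def)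
  define \<gamma> where "\<gamma> t = (p\<^sub>1 + t *s q, pull (N t) (\<lambda>a b c. (1 - t) * u\<^sub>1 a b c + t * u\<^sub>3 a b c))" for t
  have \<gamma>: "\<gamma> t \<in> regular_part n k" if "t \<in> X" for t
    unfolding \<gamma>_def Mp[symmetric]
    by (rule regular_part_pull[OF regular_part_lincomb]) (use f u3 MN that in \<open>auto simp: \<theta>\<close>)
  have \<gamma>0: "\<gamma> 0 = \<theta>\<^sub>1" by (simp add: \<gamma>_def N_def \<theta>)
  have \<gamma>1: "\<gamma> 1 = \<theta>\<^sub>2" using MN X by (simp add: \<gamma>_def \<theta> u\<^sub>3_def pull_pull q_def)
  let ?F = "frac_in {\<lambda>t. t} w X"
  have id: "(\<lambda>t. t) \<in> algebra_gen {\<lambda>t::complex. t}" by (rule algebra_gen.gen) simp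
  have w: "w \<in> algebra_gen {\<lambda>t. t}"
    unfolding w_def by (intro algebra_gen_intros id)
  have N: "?F (\<lambda>t. N t $ i $ j)" for i j
  proof -
    have "?F (\<lambda>t. (if i = j then 1 else 0) + (- t * q $ i * \<phi> $ j) / w t)"
      by (intro frac_in_add[OF w] frac_in_divide[OF w] frac_in_algebra_gen algebra_gen_intros id)
        (simp add: X_def)
    thus ?thesis unfolding N_def transvection_def by (simp only: vec_lambda_beta times_divide_eq_left)
  qed
  have coord: "?F (\<lambda>t. c (\<gamma> t))" if "c \<in> coordinates k" for c
    using that
  proof (cases rule: coordinates_cases)
    case (1 i)
    have "?F (\<lambda>t. p\<^sub>1 $ i + t * q $ i)"
      by (intro frac_in_algebra_gen algebra_gen_intros id)
    thus ?thesis by (simp add: 1 \<gamma>_def)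
  next
    case (2 a b d)
    show ?thesis unfolding 2(1) \<gamma>_def snd_conv
      by (intro frac_in_pull[OF w] N frac_in_algebra_gen algebra_gen_intros id)
  qed
  have clear: "\<exists>h \<in> algebra_gen {\<lambda>t. t}. \<exists>N. \<forall>t\<in>X. P (\<gamma> t) * w t ^ N = h t"
    if "P \<in> polynomial_functions k" for P
    using frac_in_compose[OF w that, where \<phi> = \<gamma>, OF coord]
    unfolding frac_in_def by blast
  obtain h N1 where h: "h \<in> algebra_gen {\<lambda>t. t}" "\<And>t. t \<in> X \<Longrightarrow> f (\<gamma> t) * w t ^ N1 = h t"
    using clear[OF f(1)] by blast
  obtain h' N2 where h': "h' \<in> algebra_gen {\<lambda>t. t}" "\<And>t. t \<in> X \<Longrightarrow> g (\<gamma> t) * w t ^ N2 = h' t"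
    using clear[OF g(1)] by blast
  have "h 0 \<noteq> 0" using h(2)[of 0] X f(3) by (auto simp: \<gamma>0 w1)
  moreover have "h' 1 \<noteq> 0" using h'(2)[of 1] X g(3) \<phi> by (auto simp: \<gamma>1 w1)
  moreover have "w 0 \<noteq> 0" by (simp add: w1)
  \<comment> \<open>The three polynomials are nonzero at 0, 1 and 0 respectively, so they have a
    common non-root; including \<open>w\<close> keeps it in \<open>X\<close>.\<close>
  ultimately have "\<exists>t. \<forall>f\<in>{h, h', w}. f t \<noteq> 0"
    using h(1) h'(1) w by (intro algebra_gen_univariate_common) auto
  then obtain t where "h t \<noteq> 0" "h' t \<noteq> 0" "w t \<noteq> 0" by auto
  hence t: "t \<in> X" "f (\<gamma> t) \<noteq> 0" "g (\<gamma> t) \<noteq> 0"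
    using h(2)[of t] h'(2)[of t] by (auto simp: X_def)
  thus ?thesis using \<gamma>[OF t(1)] by blast
qed

subsection \<open>Extension of jets\<close>

text \<open>Over this base point the equation is the recursion u_{a,b,c+1} = (n - a - b - c)
  u_{abc}, so the values with c = 0 are free and determine the jet.\<close>

lemma axis_jet_regular:
  "(axis 3 1, \<lambda>a b c. if a + b + c \<le> k then (\<Prod>j<c. of_nat n - of_nat (a + b + j)) * w a b else 0)
     \<in> regular_part n k"
  unfolding regular_part_iff shift_axis by (auto simp: axis_eq_0_iff)

lemma regular_part_axis_eq:
  assumes "(axis 3 1, u) \<in> regular_part n k" "a + b + c \<le> k"
  shows "u a b c = (\<Prod>j<c. of_nat n - of_nat (a + b + j)) * u a b 0"
  using assms(2)
proof (induction c)
  case (Suc c)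
  hence "u a b (Suc c) = (of_nat n - of_nat (a + b + c)) * u a b c"
    using assms(1) unfolding regular_part_iff shift_axis by auto
  thus ?case using Suc by simp
qed simp

text \<open>The projection from order \<open>l\<close> to order \<open>k\<close> is onto. After
  moving the base point to \<open>axis 3 1\<close>, the free values are kept, those above order
  \<open>k\<close> being 0, and the recursion is continued.\<close>

lemma regular_part_extend:
  assumes "\<theta> \<in> regular_part n k" "k \<le> l"
  shows "\<exists>\<theta>'\<in>regular_part n l. truncate k \<theta>' = \<theta>"
proof -
  obtain p u where \<theta>: "\<theta> = (p, u)" by (metis surj_pair)
  have "p \<noteq> 0" using assms(1) by (simp add: \<theta> regular_part_iff)
  moreover have "axis 3 (1::complex) \<noteq> (0 :: complex^3)" by (simp add: axis_eq_0_iff)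
  ultimately obtain B M :: "complex^3^3" where B: "B *v p = axis 3 1" "M *v axis 3 1 = p"
    "M ** B = mat 1" "B ** M = mat 1"
    by (rule move_base_point)
  define u' where "u' = pull M u"
  have u': "(axis 3 1, u') \<in> regular_part n k"
    using regular_part_pull[of p u n k M B] assms(1) B by (simp add: u'_def \<theta>)
  define v where "v = (\<lambda>a b c. if a + b + c \<le> l then (\<Prod>j<c. of_nat n - of_nat (a + b + j)) * u' a b 0 else 0)"
  have v: "(axis 3 1, v) \<in> regular_part n l"
    unfolding v_def by (rule axis_jet_regular)
  have "truncate k (axis 3 1, v) = truncate k (axis 3 1, u')"
  proof -
    have "v a b c = u' a b c" if "a + b + c \<le> k" for a b c
      unfolding regular_part_axis_eq[OF u' that] using that assms(2) by (simp add: v_def)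
    thus ?thesis by (simp add: truncate_def fun_eq_iff)
  qed
  hence "truncate k (p, pull B v) = truncate k (p, pull B u')"
    using truncate_pull[of k p B "axis 3 1" v] truncate_pull[of k p B "axis 3 1" u'] by simp
  also have "pull B u' = u" by (simp add: u'_def pull_pull B)
  finally have "truncate k (p, pull B v) = \<theta>" using assms(1) by (simp add: \<theta>)
  moreover have "(p, pull B v) \<in> regular_part n l"
    using regular_part_pull[OF v, of B M] B by simp
  ultimately show ?thesis by blast
qed

subsection \<open>The Hessian and the coframe\<close>

definition gradient :: "family \<Rightarrow> complex^3" where
  "gradient u = (\<chi> i. shift (axis i 1) u 0 0 0)"

definition hessian :: "family \<Rightarrow> complex^3^3" where
  "hessian u = (\<chi> i j. shift (axis i 1) (shift (axis j 1) u) 0 0 0)"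

definition det_deriv :: "complex^3^3 \<Rightarrow> complex^3^3 \<Rightarrow> complex" where
  "det_deriv H K = det (vector [K $ 1, H $ 2, H $ 3] :: complex^3^3)
     + det (vector [H $ 1, K $ 2, H $ 3] :: complex^3^3) + det (vector [H $ 1, H $ 2, K $ 3] :: complex^3^3)"

definition dhess :: "family \<Rightarrow> complex^3" where
  "dhess u = (\<chi> i. det_deriv (hessian u) (hessian (shift (axis i 1) u)))"

definition cross :: "complex^3 \<Rightarrow> complex^3 \<Rightarrow> complex^3" where
  "cross a b = vector [a $ 2 * b $ 3 - a $ 3 * b $ 2, a $ 3 * b $ 1 - a $ 1 * b $ 3,
     a $ 1 * b $ 2 - a $ 2 * b $ 1]"

text \<open>The coframe in closed form. Its third row is H (a x b), with H the Hessian and a, b the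
  first two rows; pairing it with a or b through the inverse of H gives a triple product with a
  repeated vector, hence the orthogonality.\<close>

definition frame :: "family \<Rightarrow> complex^3^3" where
  "frame u = vector [gradient u, dhess u, hessian u *v cross (gradient u) (dhess u)]"

lemma shift_at_0: "shift v u 0 0 0 = v $ 1 * gradient u $ 1 + v $ 2 * gradient u $ 2 + v $ 3 * gradient u $ 3"
  by (simp add: gradient_def) (simp add: shift_def)

lemma shift_shift_at_0:
  "shift v (shift w u) 0 0 0 = (\<Sum>i\<in>UNIV. \<Sum>j\<in>UNIV. v $ i * w $ j * hessian u $ i $ j)"
  by (simp add: hessian_def sum_3) (simp add: shift_def algebra_simps)

lemma det_deriv:
  "((\<lambda>t. det (\<chi> i j. H $ i $ j + t * K $ i $ j)) has_field_derivative det_deriv H K) (at 0)"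
  unfolding det_3 det_deriv_def
  by (auto intro!: derivative_eq_intros simp: algebra_simps)

text \<open>Both sides are the derivative at t = 0 of det(M^T (H + t K) M) = (det M)^2 det(H + t
  K).\<close>

lemma det_deriv_congruence:
  "det_deriv (transpose M ** H ** M) (transpose M ** K ** M) = (det M)\<^sup>2 * det_deriv H K"
proof -
  have "(\<chi> i j. (transpose M ** H ** M) $ i $ j + t * (transpose M ** K ** M) $ i $ j) =
      transpose M ** (\<chi> i j. H $ i $ j + t * K $ i $ j) ** M" for t
    by (simp add: vec_eq_iff matrix_matrix_mult_def sum_3 algebra_simps)
  hence "det (\<chi> i j. (transpose M ** H ** M) $ i $ j + t * (transpose M ** K ** M) $ i $ j) =
      (det M)\<^sup>2 * det (\<chi> i j. H $ i $ j + t * K $ i $ j)" for t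
    by (simp add: det_mul power2_eq_square)
  moreover have "((\<lambda>t. (det M)\<^sup>2 * det (\<chi> i j. H $ i $ j + t * K $ i $ j)) has_field_derivative
      (det M)\<^sup>2 * det_deriv H K) (at 0)"
    by (rule DERIV_cmult[OF det_deriv])
  ultimately show ?thesis
    using DERIV_unique[OF det_deriv[of "transpose M ** H ** M" "transpose M ** K ** M"]] by simp
qed

lemma hess_eq: "hess (p, u) = det (hessian u)"
  by (simp add: hess_def det_3 hessian_def numeral_2_eq_2)

text \<open>Second derivatives of a Taylor polynomial of order 3 are affine along a coordinate line,
  so the Hessian there is exactly H + t K.\<close>

lemma partial_hess:
  "partial l (\<lambda>q. hess (jet_of 2 (taylor 3 (p, u)) q)) p = dhess u $ l"
proof -
  have T1: "taylor (Suc 0) (p, w) (p + t *s axis l 1) = w 0 0 0 + t * shift (axis l 1) w 0 0 0" for w t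
  proof -
    have "sym_form (Suc 0) w v = shift v w 0 0 0" for v
      using sym_form_Suc[of 0 w v] by simp
    thus ?thesis
      by (simp add: taylor_def) (simp add: shift_def algebra_simps)
  qed
  have "hessian (snd (jet_of 2 (taylor 3 (p, u)) (p + t *s axis l 1))) =
      (\<chi> i j. hessian u $ i $ j + t * hessian (shift (axis l 1) u) $ i $ j)" for t
    by (auto simp: vec_eq_iff forall_3 hessian_def jet_of_def partials_taylor T1 numeral_3_eq_3)
      (simp_all add: shift_def)
  hence "hess (jet_of 2 (taylor 3 (p, u)) (p + t *s axis l 1)) =
      det (\<chi> i j. hessian u $ i $ j + t * hessian (shift (axis l 1) u) $ i $ j)" for t
    by (metis hess_eq surjective_pairing)
  thus ?thesis
    by (simp add: partial_def dhess_def DERIV_imp_deriv[OF det_deriv])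
qed

lemma coframe_eq: "coframe (p, u) = frame u"
proof -
  have "total_deriv 2 1 0 0 hess (p, u) = dhess u $ 1" "total_deriv 2 0 1 0 hess (p, u) = dhess u $ 2"
    "total_deriv 2 0 0 1 hess (p, u) = dhess u $ 3"
    using partial_hess[of _ p u] by (simp_all add: total_deriv_def partials_def numeral_3_eq_3)
  note A = this
  show ?thesis
    unfolding coframe_def Let_def A snd_conv
    by (simp add: frame_def vec_eq_iff forall_3 gradient_def hessian_def cross_def matrix_vector_mult_def
        sum_3 numeral_2_eq_2) (simp add: algebra_simps)
qed

lemma gradient_pull: "gradient (pull M u) = gradient u v* M"
  by (simp add: vec_eq_iff forall_3 gradient_def[of "pull M u"] shift_pull shift_at_0
      vector_matrix_mult_def matrix_vector_mult_def sum_3 axis_def algebra_simps del: shift_axis)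

lemma hessian_pull: "hessian (pull M u) = transpose M ** hessian u ** M"
  by (simp add: vec_eq_iff forall_3 hessian_def[of "pull M u"] shift_pull shift_shift_at_0
      matrix_matrix_mult_def matrix_vector_mult_def transpose_def sum_3 axis_def algebra_simps del: shift_axis)

lemma hessian_shift:
  "hessian (shift v u) $ i $ j = (\<Sum>k\<in>UNIV. v $ k * hessian (shift (axis k 1) u) $ i $ j)"
  by (simp add: hessian_def sum_3) (simp add: shift_def algebra_simps)

lemma det_deriv_lincomb:
  "(\<Sum>k\<in>UNIV. v $ k * det_deriv H (K k)) = det_deriv H (\<chi> i j. \<Sum>k\<in>UNIV. v $ (k::3) * K k $ i $ j)"
  by (simp add: det_deriv_def det_3 sum_3 algebra_simps)

lemma dhess_apply: "(\<Sum>k\<in>UNIV. v $ k * dhess u $ k) = det_deriv (hessian u) (hessian (shift v u))"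
proof -
  have "hessian (shift v u) = (\<chi> i j. \<Sum>k\<in>UNIV. v $ k * hessian (shift (axis k 1) u) $ i $ j)"
    by (simp add: vec_eq_iff hessian_shift[of v u])
  thus ?thesis
    by (simp add: dhess_def det_deriv_lincomb)
qed

lemma dhess_pull: "dhess (pull M u) = (det M)\<^sup>2 *s (dhess u v* M)"
proof -
  have "dhess (pull M u) $ l = (det M)\<^sup>2 * (\<Sum>k\<in>UNIV. (M *v axis l 1) $ k * dhess u $ k)" for l
    unfolding dhess_apply
    by (simp add: dhess_def shift_pull hessian_pull det_deriv_congruence)
  thus ?thesis
    by (simp add: vec_eq_iff vector_matrix_mult_def matrix_vector_mult_def axis_def sum_3 forall_3 mult.commute)
qed

text \<open>The cofactor rule (M^T a) x (M^T b) = det M M^{-1} (a x b), multiplied by M so that no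
  inverse occurs.\<close>

lemma cross_pull: "M *v cross (a v* M) (b v* M) = det M *s cross a b"
  by (simp add: vec_eq_iff forall_3 matrix_vector_mult_def vector_matrix_mult_def cross_def sum_3 det_3)
    (simp add: algebra_simps)

lemma frame_pull:
  assumes "det M = 1"
  shows "frame (pull M u) = frame u ** M"
proof -
  have "hessian (pull M u) *v cross (gradient (pull M u)) (dhess (pull M u)) =
      transpose M *v (hessian u *v (M *v cross (gradient u v* M) (dhess u v* M)))"
    by (simp add: hessian_pull gradient_pull dhess_pull assms matrix_vector_mul_assoc matrix_mul_assoc)
  also have "\<dots> = (hessian u *v cross (gradient u) (dhess u)) v* M"
    by (simp add: cross_pull assms)
  finally have "hessian (pull M u) *v cross (gradient (pull M u)) (dhess (pull M u)) =
    (hessian u *v cross (gradient u) (dhess u)) v* M" .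
  thus ?thesis
    unfolding frame_def
    by (simp add: gradient_pull dhess_pull assms)
      (simp add: vec_eq_iff forall_3 matrix_matrix_mult_def vector_matrix_mult_def sum_3 mult.commute)
qed

definition adjugate :: "complex^3^3 \<Rightarrow> complex^3^3" where
  "adjugate C = transpose (vector [cross (C $ 2) (C $ 3), cross (C $ 3) (C $ 1), cross (C $ 1) (C $ 2)])"

text \<open>Cramer's formula instead of the chosen \<open>matrix_inv\<close>: the entries are
  visibly polynomials divided by the determinant.\<close>

definition inverse3 :: "complex^3^3 \<Rightarrow> complex^3^3" where
  "inverse3 C = (\<chi> i j. adjugate C $ i $ j / det C)"

lemma inverse3:
  assumes "det C \<noteq> 0"
  shows "C ** inverse3 C = mat 1" "inverse3 C ** C = mat 1"
proof -
  have "(C ** adjugate C) $ i $ j = (if i = j then det C else 0)" for i j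
    using exhaust_3[of i] exhaust_3[of j]
    by (auto simp: matrix_matrix_mult_def adjugate_def transpose_def cross_def sum_3 det_3 algebra_simps)
  hence "(C ** inverse3 C) $ i $ j = (if i = j then 1 else 0)" for i j
    using assms
    by (simp add: matrix_matrix_mult_def inverse3_def flip: sum_divide_distrib)
  thus "C ** inverse3 C = mat 1" by (simp add: vec_eq_iff mat_def)
  thus "inverse3 C ** C = mat 1" using matrix_left_right_inverse by blast
qed

text \<open>Evaluating the defining equation at C^{-1} v, with C the coframe, forces the
  coefficients to be those of the forms pulled back along C^{-1}.\<close>

lemma coeff_inv_eq:
  assumes "det (frame u) \<noteq> 0"
  shows "coeff_inv i j k (p, u) = pull (inverse3 (frame u)) u i j k"
proof -
  let ?I = "pull (inverse3 (frame u)) u"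
  have "(THE I. \<forall>m v. sym_form m u v = sym_form m I (frame u *v v)) = ?I"
  proof (rule the_equality)
    show "\<forall>m v. sym_form m u v = sym_form m ?I (frame u *v v)"
      by (simp add: sym_form_pull matrix_vector_mul_assoc inverse3 assms)
  next
    fix I assume I: "\<forall>m v. sym_form m u v = sym_form m I (frame u *v v)"
    show "I = ?I"
    proof ((rule ext)+, rule sym_form_unique[OF _ refl])
      fix a b c v
      show "sym_form (a + b + c) I v = sym_form (a + b + c) ?I v"
        using I by (simp add: sym_form_pull matrix_vector_mul_assoc inverse3 assms)
    qed
  qed
  thus ?thesis by (simp add: coeff_inv_def coframe_eq)
qed

text \<open>No nondegeneracy is assumed: as v -> M v is onto, the two conditions under
  \<open>THE\<close> are equivalent, so even unspecified values agree. The base points are arbitrary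
  because the coframe depends only on the derivatives.\<close>

lemma coeff_inv_pull:
  assumes "M ** B = mat 1" "det M = 1"
  shows "coeff_inv i j k (q, pull M u) = coeff_inv i j k (p, u)"
proof -
  have "(\<forall>m v. sym_form m (pull M u) v = sym_form m I (frame (pull M u) *v v)) \<longleftrightarrow>
      (\<forall>m v. sym_form m u v = sym_form m I (frame u *v v))" for I
  proof -
    have "(\<forall>m v. sym_form m (pull M u) v = sym_form m I (frame (pull M u) *v v)) \<longleftrightarrow>
        (\<forall>m v. sym_form m u (M *v v) = sym_form m I (frame u *v (M *v v)))"
      by (simp add: sym_form_pull frame_pull assms matrix_vector_mul_assoc)
    also have "\<dots> \<longleftrightarrow> (\<forall>m v. sym_form m u v = sym_form m I (frame u *v v))"
      by (metis assms(1) matrix_vector_mul_assoc matrix_vector_mul_lid)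
    finally show ?thesis .
  qed
  thus ?thesis by (simp add: coeff_inv_def coframe_eq)
qed

subsection \<open>The normalised jet\<close>

text \<open>
  The Gram matrix of $2 \Theta_2$ in the coframe is \<open>hessian I\<close>. As $\omega_3$ is orthogonal to
  $\omega_1$ and $\omega_2$, the vector $\omega_1 \times \omega_2$ is the dual basis vector of
  $\omega_3$ up to the factor \<open>det (frame u)\<close>, which yields that determinant.
\<close>

lemma det_frame_I002:
  assumes "det (frame u) \<noteq> 0"
  shows "det (frame u) * pull (inverse3 (frame u)) u 0 0 2 = 1"
proof -
  let ?C = "frame u" and ?I = "pull (inverse3 (frame u)) u"
  let ?N = "cross (gradient u) (dhess u)"
  have u: "pull ?C ?I = u" by (simp add: pull_pull inverse3 assms)
  \<comment> \<open>\<open>?N\<close> is orthogonal to the first two rows, and its product with the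
    third is their triple product, the determinant.\<close>
  have CN: "?C *v ?N = det ?C *s axis 3 1"
    by (simp add: vec_eq_iff forall_3 frame_def cross_def matrix_vector_mult_def sum_3 det_3 axis_def)
      (simp add: algebra_simps)
  have "hessian u = transpose ?C ** hessian ?I ** ?C"
    using hessian_pull[of ?C ?I] by (simp only: u)
  hence "hessian u *v ?N = transpose ?C *v (hessian ?I *v (?C *v ?N))"
    by (metis matrix_vector_mul_assoc)
  also have "hessian u *v ?N = transpose ?C *v axis 3 1"
    by (simp add: vec_eq_iff vector_matrix_mult_def axis_def sum_3 frame_def)
  finally have eq: "transpose ?C *v (hessian ?I *v (?C *v ?N)) = transpose ?C *v axis 3 1" ..
  have inj: "transpose (inverse3 ?C) *v (transpose ?C *v x) = x" for x
  proof -
    have "transpose (inverse3 ?C) ** transpose ?C = mat 1"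
      by (metis inverse3(1)[OF assms] matrix_transpose_mul transpose_mat)
    thus ?thesis by (simp only: matrix_vector_mul_assoc matrix_vector_mul_lid)
  qed
  have "hessian ?I *v (?C *v ?N) = axis 3 1"
    using arg_cong[OF eq, of "(*v) (transpose (inverse3 ?C))"] by (simp only: inj)
  hence "(hessian ?I *v (?C *v ?N)) $ 3 = 1" by simp
  moreover have "hessian ?I $ 3 $ 3 = ?I 0 0 2"
    by (simp add: hessian_def numeral_2_eq_2)
  ultimately show ?thesis
    unfolding CN by (simp add: matrix_vector_mult_def sum_3 axis_def mult.commute)
qed

lemma euler_gradient:
  assumes "(p, u) \<in> regular_part n k" "1 \<le> k"
  shows "p $ 1 * gradient u $ 1 + p $ 2 * gradient u $ 2 + p $ 3 * gradient u $ 3 = of_nat n * u 0 0 0"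
  using assms shift_at_0[of p u] by (auto simp: regular_part_iff)

lemma euler_hessian:
  assumes "(p, u) \<in> regular_part n k" "2 \<le> k"
  shows "p v* hessian u = (of_nat n - 1) *s gradient u"
proof -
  have "shift p u a b c = (of_nat n - 1) * u a b c" if "a + b + c = 1" for a b c
    using assms that by (auto simp: regular_part_iff simp del: of_nat_add)
  hence "shift (axis i 1) (shift p u) 0 0 0 = (of_nat n - 1) * gradient u $ i" for i
    using exhaust_3[of i] by (auto simp: gradient_def)
  hence eq: "shift p (shift (axis i 1) u) 0 0 0 = (of_nat n - 1) * gradient u $ i" for i
    using shift_commute[of p "axis i 1" u] by simp
  show ?thesis
    using eq[of 1] eq[of 2] eq[of 3] unfolding shift_shift_at_0
    by (simp add: vec_eq_iff forall_3 vector_matrix_mult_def sum_3 axis_def algebra_simps)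
qed

text \<open>A is cubic in the second derivatives, which are homogeneous of degree n - 2, so A is
  homogeneous of degree 3 (n - 2).\<close>

lemma euler_dhess:
  assumes "(p, u) \<in> regular_part n k" "3 \<le> k"
  shows "p $ 1 * dhess u $ 1 + p $ 2 * dhess u $ 2 + p $ 3 * dhess u $ 3 =
    3 * (of_nat n - 2) * det (hessian u)"
proof -
  have "shift p u a b c = (of_nat n - 2) * u a b c" if "a + b + c = 2" for a b c
  proof -
    have "shift p u a b c = (of_nat n - of_nat (a + b + c)) * u a b c"
      using assms that by (auto simp: regular_part_iff simp del: of_nat_add)
    thus ?thesis using that by simp
  qed
  hence "hessian (shift p u) = (\<chi> i j. (of_nat n - 2) * hessian u $ i $ j)"
    by (simp add: vec_eq_iff forall_3 hessian_def)
  thus ?thesis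
    using dhess_apply[of p u] by (simp add: sum_3 det_deriv_def det_3 algebra_simps)
qed

lemma frame_base_point:
  assumes reg: "(p, u) \<in> regular_part n k" "3 \<le> k" and nondeg: "det (frame u) \<noteq> 0"
  shows "frame u *v p = vector [of_nat n * u 0 0 0,
    3 * (of_nat n - 2) * det (hessian (pull (inverse3 (frame u)) u)) * (det (frame u))\<^sup>2, 0]"
proof -
  let ?C = "frame u" and ?I = "pull (inverse3 (frame u)) u"
  let ?N = "cross (gradient u) (dhess u)"
  have "pull ?C ?I = u" by (simp add: pull_pull inverse3 nondeg)
  hence "hessian u = transpose ?C ** hessian ?I ** ?C"
    using hessian_pull[of ?C ?I] by simp
  hence det: "det (hessian u) = det (hessian ?I) * (det ?C)\<^sup>2"
    by (metis (no_types, lifting) det_mul det_transpose mult.assoc mult.commute power2_eq_square)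
  \<comment> \<open>Contracting the Hessian with p gives a multiple of the gradient, which is
    orthogonal to \<open>?N\<close>; so omega_3 vanishes on p.\<close>
  have "(hessian u *v ?N) $ 1 * p $ 1 + (hessian u *v ?N) $ 2 * p $ 2 + (hessian u *v ?N) $ 3 * p $ 3 =
      (p v* hessian u) $ 1 * ?N $ 1 + (p v* hessian u) $ 2 * ?N $ 2 + (p v* hessian u) $ 3 * ?N $ 3"
    by (simp add: matrix_vector_mult_def vector_matrix_mult_def sum_3 algebra_simps)
  also have "\<dots> = 0"
    using reg by (simp add: euler_hessian) (simp add: cross_def algebra_simps)
  finally have 3: "(hessian u *v ?N) $ 1 * p $ 1 + (hessian u *v ?N) $ 2 * p $ 2 +
      (hessian u *v ?N) $ 3 * p $ 3 = 0" .
  have "(?C *v p) $ 1 = of_nat n * u 0 0 0"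
    using euler_gradient[OF reg(1)] reg(2) by (simp add: matrix_vector_mult_def frame_def sum_3 mult.commute)
  moreover have "(?C *v p) $ 2 = 3 * (of_nat n - 2) * det (hessian ?I) * (det ?C)\<^sup>2"
    using euler_dhess[OF reg] det by (simp add: matrix_vector_mult_def frame_def sum_3 mult.commute)
  moreover have "(?C *v p) $ 3 = 0"
    using 3 by (simp add: matrix_vector_mult_def[of ?C]) (simp add: frame_def sum_3)
  ultimately show ?thesis by (simp add: vec_eq_iff forall_3)
qed

text \<open>
  The determinant is a sum of two terms, one of which vanishes for $n = 0$ and the other for
  $n = 2$; the sign of $u_{000} = -1$ keeps the sum positive for the remaining $n$.
\<close>

lemma frame_nondegenerate:
  assumes "n \<noteq> 1" "3 \<le> k"
  shows "\<exists>(p, u) \<in> regular_part n k. det (frame u) \<noteq> 0"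
proof -
  \<comment> \<open>The values of u_{100} and u_{020} make A = -(n - 1)^2 nonzero. Without u_{030}
    the differential of A would vanish for n = 2.\<close>
  define w :: "nat \<Rightarrow> nat \<Rightarrow> complex" where
    "w a b = (if a = 0 \<and> b = 0 then - 1 else if a = 1 \<and> b = 0 then 1
       else if a = 0 \<and> (b = 2 \<or> b = 3) then 1 else 0)" for a b
  define u where
    "u = (\<lambda>a b c. if a + b + c \<le> k then (\<Prod>j<c. of_nat n - of_nat (a + b + j)) * w a b else 0)"
  have reg: "(axis 3 1, u) \<in> regular_part n k"
    unfolding u_def by (rule axis_jet_regular)
  have u: "u a b c = (\<Prod>j<c. of_nat n - of_nat (a + b + j)) * w a b" if "a + b + c \<le> 3" for a b c
    using that assms(2) by (simp add: u_def)
  let ?n = "of_nat n :: complex"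
  have grad: "gradient u = vector [1, 0, - ?n]"
    by (simp add: vec_eq_iff forall_3 gradient_def u w_def)
  have hess: "hessian u = vector [vector [0, 0, ?n - 1], vector [0, 1, 0], vector [?n - 1, 0, - ?n * (?n - 1)]]"
    by (simp add: vec_eq_iff forall_3 hessian_def u w_def lessThan_Suc)
  have third: "hessian (shift (axis 1 1) u) = vector [vector [0, 0, 0], vector [0, 0, 0], vector [0, 0, (?n - 1) * (?n - 2)]]"
    "hessian (shift (axis 2 1) u) = vector [vector [0, 0, 0], vector [0, 1, ?n - 2], vector [0, ?n - 2, 0]]"
    "hessian (shift (axis 3 1) u) = vector [vector [0, 0, (?n - 1) * (?n - 2)], vector [0, ?n - 2, 0],
        vector [(?n - 1) * (?n - 2), 0, - ?n * (?n - 1) * (?n - 2)]]"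
    by (simp_all add: vec_eq_iff forall_3 hessian_def u w_def lessThan_Suc)
  have dhess: "dhess u = vector [0, - (?n - 1)\<^sup>2, - 3 * (?n - 2) * (?n - 1)\<^sup>2]"
    unfolding dhess_def hess
    by (simp add: vec_eq_iff forall_3 third det_deriv_def det_3 del: shift_axis)
      (simp add: algebra_simps power2_eq_square)
  have "det (frame u) = (?n - 1)^4 * (9 * (?n - 2)\<^sup>2 + ?n * (?n - 1))"
    unfolding frame_def grad dhess hess
    by (simp add: det_3 cross_def matrix_vector_mult_def sum_3) algebra
  also have "\<dots> = complex_of_real ((real n - 1)^4 * (9 * (real n - 2)\<^sup>2 + real n * (real n - 1)))"
    by simp
  also have "(real n - 1)^4 * (9 * (real n - 2)\<^sup>2 + real n * (real n - 1)) \<noteq> 0"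
  proof (cases "n = 0")
    case False
    hence "real n * (real n - 1) > 0" using assms(1) by simp
    moreover have "9 * (real n - 2)\<^sup>2 \<ge> 0" by simp
    ultimately have "9 * (real n - 2)\<^sup>2 + real n * (real n - 1) > 0" by linarith
    thus ?thesis using assms(1) by auto
  qed simp
  hence "complex_of_real ((real n - 1)^4 * (9 * (real n - 2)\<^sup>2 + real n * (real n - 1))) \<noteq> 0"
    by (subst of_real_eq_0_iff)
  finally show ?thesis using reg by blast
qed

subsection \<open>Generic properties\<close>

lemma generically_mono:
  assumes "generically n k \<phi>" "\<And>\<theta>. \<theta> \<in> regular_part n k \<Longrightarrow> \<phi> \<theta> \<Longrightarrow> \<psi> \<theta>"
  shows "generically n k \<psi>"
  using assms unfolding generically_def by blast

text \<open>Irreducibility enters here: two nonempty open sets of the regular part meet.\<close>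

lemma generically_conj:
  assumes "generically n k \<phi>" "generically n k \<psi>"
  shows "generically n k (\<lambda>\<theta>. \<phi> \<theta> \<and> \<psi> \<theta>)"
proof -
  from assms obtain S T \<theta>\<^sub>1 \<theta>\<^sub>2 where S: "S \<in> polynomial_functions k" "\<theta>\<^sub>1 \<in> regular_part n k" "S \<theta>\<^sub>1 \<noteq> 0"
      "\<And>\<theta>. \<theta> \<in> regular_part n k \<Longrightarrow> S \<theta> \<noteq> 0 \<Longrightarrow> \<phi> \<theta>"
    and T: "T \<in> polynomial_functions k" "\<theta>\<^sub>2 \<in> regular_part n k" "T \<theta>\<^sub>2 \<noteq> 0"
      "\<And>\<theta>. \<theta> \<in> regular_part n k \<Longrightarrow> T \<theta> \<noteq> 0 \<Longrightarrow> \<psi> \<theta>"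
    unfolding generically_def by blast
  obtain \<theta> where "\<theta> \<in> regular_part n k" "S \<theta> \<noteq> 0 \<and> T \<theta> \<noteq> 0"
    using regular_part_irreducible[OF S(1-3) T(1-3)] by blast
  moreover have "(\<lambda>\<theta>. S \<theta> * T \<theta>) \<in> polynomial_functions k"
    by (intro algebra_gen.mult S T)
  ultimately show ?thesis
    unfolding generically_def using S(4) T(4) by (intro bexI[of _ "\<lambda>\<theta>. S \<theta> * T \<theta>"]) auto
qed

lemma generically_ex: "generically n k \<phi> \<Longrightarrow> \<exists>\<theta>\<in>regular_part n k. \<phi> \<theta>"
  unfolding generically_def by blast

lemma generically_nonzero:
  "f \<in> polynomial_functions k \<Longrightarrow> \<theta> \<in> regular_part n k \<Longrightarrow> f \<theta> \<noteq> 0 \<Longrightarrow> generically n k (\<lambda>\<theta>. f \<theta> \<noteq> 0)"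
  unfolding generically_def by blast

lemma generically_all:
  assumes "\<And>\<theta>. \<theta> \<in> regular_part n k \<Longrightarrow> \<phi> \<theta>"
  shows "generically n k \<phi>"
  by (rule generically_mono[OF generically_nonzero[OF algebra_gen.const[of 1] axis_jet_regular]])
    (simp_all add: assms)

text \<open>This turns generic polynomial identities into identities at any prescribed regular
  jet.\<close>

lemma generically_eq:
  assumes "f \<in> polynomial_functions k" "g \<in> polynomial_functions k"
    and "generically n k (\<lambda>\<theta>. f \<theta> = g \<theta>)" "\<theta> \<in> regular_part n k"
  shows "f \<theta> = g \<theta>"
proof (rule ccontr)
  assume "f \<theta> \<noteq> g \<theta>"
  hence "generically n k (\<lambda>\<theta>. f \<theta> - g \<theta> \<noteq> 0)"
    using assms by (intro generically_nonzero[OF algebra_gen_diff]) auto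
  from generically_ex[OF generically_conj[OF this assms(3)]] show False by auto
qed

lemma coordinate_base: "(\<lambda>\<theta>. fst \<theta> $ i) \<in> polynomial_functions k"
  by (rule algebra_gen.gen) (auto simp: coordinates_def)

lemma coordinate_fibre: "a + b + c \<le> k \<Longrightarrow> (\<lambda>\<theta>. snd \<theta> a b c) \<in> polynomial_functions k"
  by (rule algebra_gen.gen) (auto simp: coordinates_def)

lemma polynomial_functions_mono: "f \<in> polynomial_functions k \<Longrightarrow> k \<le> l \<Longrightarrow> f \<in> polynomial_functions l"
  by (erule algebra_gen_mono) (fastforce simp: coordinates_def dest: order_trans)

lemma polynomial_truncate: "f \<in> polynomial_functions k \<Longrightarrow> f (truncate k \<theta>) = f \<theta>"
  by (induction rule: algebra_gen.induct) (auto simp: coordinates_def truncate_def)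

text \<open>As every regular jet extends to higher order, a nonempty open set has a nonempty
  preimage under truncation.\<close>

lemma generically_truncate:
  assumes "generically n k \<phi>" "k \<le> l"
  shows "generically n l (\<lambda>\<theta>. \<phi> (truncate k \<theta>))"
proof -
  from assms(1) obtain S \<theta> where S: "S \<in> polynomial_functions k" "\<theta> \<in> regular_part n k" "S \<theta> \<noteq> 0"
      "\<And>\<theta>. \<theta> \<in> regular_part n k \<Longrightarrow> S \<theta> \<noteq> 0 \<Longrightarrow> \<phi> \<theta>"
    unfolding generically_def by blast
  obtain \<theta>' where \<theta>': "\<theta>' \<in> regular_part n l" "truncate k \<theta>' = \<theta>"
    using regular_part_extend[OF S(2) assms(2)] by blast
  hence "S \<theta>' \<noteq> 0" using S(3) polynomial_truncate[OF S(1)] by metis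
  from generically_nonzero[OF polynomial_functions_mono[OF S(1) assms(2)] \<theta>'(1) this]
  show ?thesis
    by (rule generically_mono)
      (use S(4) polynomial_truncate[OF S(1)] truncate_mem_regular_part assms(2) in metis)
qed

lemma inverse3_det_1:
  assumes "det B = 1"
  shows "inverse3 B ** B = mat 1" "B ** inverse3 B = mat 1" "det (inverse3 B) = 1"
proof -
  show *: "inverse3 B ** B = mat 1" "B ** inverse3 B = mat 1"
    using assms by (simp_all add: inverse3)
  show "det (inverse3 B) = 1"
    using arg_cong[OF *(1), of det] assms by (simp add: det_mul)
qed

lemma prolong_regular_part:
  assumes "(p, u) \<in> regular_part n k" "det B = 1"
  shows "prolong k B (p, u) = (B *v p, pull (inverse3 B) u)" "prolong k B (p, u) \<in> regular_part n k"
proof -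
  have reg: "(B *v p, pull (inverse3 B) u) \<in> regular_part n k"
    using regular_part_pull[OF assms(1)] inverse3_det_1[OF assms(2)] by blast
  thus "prolong k B (p, u) = (B *v p, pull (inverse3 B) u)"
    using prolong_eq[OF inverse3_det_1(1,2)[OF assms(2)]] by simp
  thus "prolong k B (p, u) \<in> regular_part n k" using reg by simp
qed

text \<open>\<open>prolong\<close> is defined by differentiation, but on the regular part it is a
  linear map with constant entries.\<close>

lemma polynomial_prolong:
  assumes "f \<in> polynomial_functions k" "det B = 1"
  obtains g where "g \<in> polynomial_functions k" "\<And>\<theta>. \<theta> \<in> regular_part n k \<Longrightarrow> f (prolong k B \<theta>) = g \<theta>"
proof -
  define \<phi> :: "jet \<Rightarrow> jet" where "\<phi> \<theta> = (B *v fst \<theta>, pull (inverse3 B) (snd \<theta>))" for \<theta>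
  have "frac_in (coordinates k) (\<lambda>_. 1) UNIV (\<lambda>\<theta>. f (\<phi> \<theta>))"
  proof (rule frac_in_compose[OF algebra_gen.const assms(1)])
    fix c assume "c \<in> coordinates k"
    thus "frac_in (coordinates k) (\<lambda>_. 1) UNIV (\<lambda>\<theta>. c (\<phi> \<theta>))"
    proof (cases rule: coordinates_cases)
      case (1 i)
      thus ?thesis
        by (auto simp: \<phi>_def matrix_vector_mult_def sum_3 intro!: algebra_gen.add algebra_gen.mult
            algebra_gen.const coordinate_base)
    next
      case (2 a b d)
      show ?thesis unfolding 2(1) \<phi>_def snd_conv
        by (intro frac_in_pull algebra_gen.const frac_in_const frac_in_algebra_gen coordinate_fibre)
          (use 2(2) in simp)
    qed
  qed
  moreover have "f (prolong k B \<theta>) = f (\<phi> \<theta>)" if "\<theta> \<in> regular_part n k" for \<theta>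
    using prolong_regular_part(1)[of "fst \<theta>" "snd \<theta>" n k B] that assms(2) by (simp add: \<phi>_def)
  ultimately show thesis using that[of "\<lambda>\<theta>. f (\<phi> \<theta>)"] by simp
qed

lemma generically_prolong:
  assumes "generically n k \<phi>" "det B = 1"
  shows "generically n k (\<lambda>\<theta>. \<phi> (prolong k B \<theta>))"
proof -
  from assms(1) obtain S \<theta> where S: "S \<in> polynomial_functions k" "\<theta> \<in> regular_part n k" "S \<theta> \<noteq> 0"
      "\<And>\<theta>. \<theta> \<in> regular_part n k \<Longrightarrow> S \<theta> \<noteq> 0 \<Longrightarrow> \<phi> \<theta>"
    unfolding generically_def by blast
  obtain g where g: "g \<in> polynomial_functions k"
    "\<And>\<theta>. \<theta> \<in> regular_part n k \<Longrightarrow> S (prolong k B \<theta>) = g \<theta>"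
    using polynomial_prolong[OF S(1) assms(2)] by blast
  note inv = inverse3_det_1[OF assms(2)]
  have reg: "(inverse3 B *v fst \<theta>, pull B (snd \<theta>)) \<in> regular_part n k"
    using S(2) inv(2) by (intro regular_part_pull) auto
  have "pull (inverse3 B) (pull B (snd \<theta>)) = snd \<theta>" "B *v (inverse3 B *v fst \<theta>) = fst \<theta>"
    by (simp_all add: pull_pull matrix_vector_mul_assoc inv)
  hence "prolong k B (inverse3 B *v fst \<theta>, pull B (snd \<theta>)) = \<theta>"
    by (simp add: prolong_regular_part(1)[OF reg assms(2)])
  hence "g (inverse3 B *v fst \<theta>, pull B (snd \<theta>)) \<noteq> 0"
    using g(2)[OF reg] S(3) by simp
  from generically_nonzero[OF g(1) reg this] show ?thesis
  proof (rule generically_mono)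
    fix \<theta> assume "\<theta> \<in> regular_part n k" "g \<theta> \<noteq> 0"
    thus "\<phi> (prolong k B \<theta>)"
      using S(4)[of "prolong k B \<theta>"] g(2)[of \<theta>] prolong_regular_part(2)[of "fst \<theta>" "snd \<theta>" n k B] assms(2)
      by simp
  qed
qed

subsection \<open>Polynomial dependence of the coframe\<close>

lemma algebra_gen_shift:
  assumes "\<And>a b c. a + b + c = Suc m \<Longrightarrow> (\<lambda>x. U x a b c) \<in> algebra_gen G" "a + b + c = m"
  shows "(\<lambda>x. shift v (U x) a b c) \<in> algebra_gen G"
  using frac_in_shift[of "\<lambda>_. 1" G UNIV "\<lambda>_. v" m U a b c] assms
  by (simp add: algebra_gen.const)

lemma algebra_gen_det:
  fixes A :: "'a \<Rightarrow> complex^3^3"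
  assumes "\<And>i j. (\<lambda>x. A x $ i $ j) \<in> algebra_gen G"
  shows "(\<lambda>x. det (A x)) \<in> algebra_gen G"
  unfolding det_3 by (intro algebra_gen_diff algebra_gen.add algebra_gen.mult assms)

lemma algebra_gen_hessian:
  assumes "\<And>a b c. a + b + c = 2 \<Longrightarrow> (\<lambda>x. U x a b c) \<in> algebra_gen G"
  shows "(\<lambda>x. hessian (U x) $ i $ j) \<in> algebra_gen G"
proof -
  have "(\<lambda>x. shift (axis j 1) (U x) a b c) \<in> algebra_gen G" if "a + b + c = 1" for a b c
    by (rule algebra_gen_shift[OF _ that]) (simp add: assms)
  hence "(\<lambda>x. shift (axis i 1) (shift (axis j 1) (U x)) 0 0 0) \<in> algebra_gen G"
    by (rule algebra_gen_shift[where m = 0]) simp_all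
  thus ?thesis by (simp add: hessian_def)
qed

lemma algebra_gen_cross:
  assumes "\<And>i. (\<lambda>x. a x $ i) \<in> algebra_gen G" "\<And>i. (\<lambda>x. b x $ i) \<in> algebra_gen G"
  shows "(\<lambda>x. cross (a x) (b x) $ i) \<in> algebra_gen G"
  using exhaust_3[of i] unfolding cross_def
  by (auto intro!: algebra_gen_diff algebra_gen.mult assms)

lemma algebra_gen_adjugate:
  assumes "\<And>i j. (\<lambda>x. A x $ i $ j) \<in> algebra_gen G"
  shows "(\<lambda>x. adjugate (A x) $ i $ j) \<in> algebra_gen G"
  using exhaust_3[of j] unfolding adjugate_def transpose_def
  by (auto intro!: algebra_gen_cross assms)

lemma polynomial_frame:
  assumes "3 \<le> k"
  shows "(\<lambda>\<theta>. frame (snd \<theta>) $ i $ j) \<in> polynomial_functions k"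
proof -
  have sh: "(\<lambda>\<theta>. shift v (snd \<theta>) a b c) \<in> polynomial_functions k" if "a + b + c \<le> 2" for v a b c
    by (rule algebra_gen_shift[OF _ refl], rule coordinate_fibre) (use that assms in simp)
  have hess: "(\<lambda>\<theta>. hessian (snd \<theta>) $ i $ j) \<in> polynomial_functions k" for i j
    by (rule algebra_gen_hessian, rule coordinate_fibre) (use assms in simp)
  have third: "(\<lambda>\<theta>. hessian (shift v (snd \<theta>)) $ i $ j) \<in> polynomial_functions k" for v i j
    by (rule algebra_gen_hessian, rule sh) simp
  have grad: "(\<lambda>\<theta>. gradient (snd \<theta>) $ i) \<in> polynomial_functions k" for i
    unfolding gradient_def vec_lambda_beta by (rule sh) simp
  have dhess: "(\<lambda>\<theta>. dhess (snd \<theta>) $ i) \<in> polynomial_functions k" for i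
    unfolding dhess_def vec_lambda_beta det_deriv_def det_3 vector_3
    by (intro algebra_gen_diff algebra_gen.add algebra_gen.mult hess third)
  note cross = algebra_gen_cross[OF grad dhess]
  show ?thesis
    using exhaust_3[of i] unfolding frame_def
    by (auto simp: matrix_vector_mult_def sum_3 intro!: grad dhess algebra_gen.add algebra_gen.mult hess cross)
qed

lemma polynomial_det_frame: "3 \<le> k \<Longrightarrow> (\<lambda>\<theta>. det (frame (snd \<theta>))) \<in> polynomial_functions k"
  by (intro algebra_gen_det polynomial_frame)

lemma generically_frame:
  assumes "n \<noteq> 1" "3 \<le> k"
  shows "generically n k (\<lambda>\<theta>. det (frame (snd \<theta>)) \<noteq> 0)"
proof -
  obtain p u where "(p, u) \<in> regular_part n k" "det (frame u) \<noteq> 0"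
    using frame_nondegenerate[OF assms] by blast
  thus ?thesis using generically_nonzero[OF polynomial_det_frame[OF assms(2)]] by fastforce
qed

lemma frac_in_inverse3:
  assumes A: "\<And>i j. (\<lambda>x. A x $ i $ j) \<in> algebra_gen G" and X: "\<And>x. x \<in> X \<Longrightarrow> det (A x) \<noteq> 0"
  shows "frac_in G (\<lambda>x. det (A x)) X (\<lambda>x. inverse3 (A x) $ i $ j)"
  unfolding inverse3_def vec_lambda_beta
  by (intro frac_in_divide frac_in_algebra_gen algebra_gen_det algebra_gen_adjugate A X)

subsection \<open>The coefficients are invariants\<close>

lemma rational_invariant_coeff_inv:
  assumes "n \<noteq> 1" "3 \<le> k" "a + b + c \<le> k"
  shows "rational_invariant n k (coeff_inv a b c)"
  unfolding rational_invariant_def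
proof (intro conjI allI impI)
  let ?w = "\<lambda>\<theta>. det (frame (snd \<theta>))" and ?X = "{\<theta>. det (frame (snd \<theta>)) \<noteq> 0}"
  have "frac_in (coordinates k) ?w ?X (\<lambda>\<theta>. pull (inverse3 (frame (snd \<theta>))) (snd \<theta>) a b c)"
    using assms
    by (intro frac_in_pull frac_in_inverse3 polynomial_det_frame polynomial_frame frac_in_algebra_gen
        coordinate_fibre) auto
  then obtain N h where h: "h \<in> polynomial_functions k"
    "\<And>\<theta>. ?w \<theta> \<noteq> 0 \<Longrightarrow> pull (inverse3 (frame (snd \<theta>))) (snd \<theta>) a b c * ?w \<theta> ^ N = h \<theta>"
    unfolding frac_in_def by blast
  have "generically n k (\<lambda>\<theta>. ?w \<theta> ^ N \<noteq> 0 \<and> coeff_inv a b c \<theta> = h \<theta> / ?w \<theta> ^ N)"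
  proof (rule generically_mono[OF generically_frame[OF assms(1,2)]])
    fix \<theta> :: jet assume "?w \<theta> \<noteq> 0"
    thus "?w \<theta> ^ N \<noteq> 0 \<and> coeff_inv a b c \<theta> = h \<theta> / ?w \<theta> ^ N"
      using h(2)[of \<theta>] coeff_inv_eq[of "snd \<theta>" a b c "fst \<theta>"] by (simp add: field_simps)
  qed
  moreover have "(\<lambda>\<theta>. ?w \<theta> ^ N) \<in> polynomial_functions k"
    by (intro algebra_gen_power polynomial_det_frame assms)
  ultimately show "rational_in n k (coordinates k) (coeff_inv a b c)"
    unfolding rational_in_def using h(1)
    by (intro bexI[of _ h] bexI[of _ "\<lambda>\<theta>. ?w \<theta> ^ N"])
next
  fix B :: "complex^3^3" assume B: "det B = 1"
  show "generically n k (\<lambda>\<theta>. coeff_inv a b c (prolong k B \<theta>) = coeff_inv a b c \<theta>)"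
  proof (rule generically_all)
    fix \<theta> assume "\<theta> \<in> regular_part n k"
    hence "prolong k B \<theta> = (B *v fst \<theta>, pull (inverse3 B) (snd \<theta>))"
      using prolong_regular_part(1)[of "fst \<theta>" "snd \<theta>"] B by simp
    thus "coeff_inv a b c (prolong k B \<theta>) = coeff_inv a b c \<theta>"
      using coeff_inv_pull[of "inverse3 B" B a b c _ "snd \<theta>" "fst \<theta>"] inverse3_det_1[OF B] by simp
  qed
qed

text \<open>In degrees 0 and 1 the coframe drops out: I_000 = u_000, and Theta_1 = omega_1 gives
  I_100 = 1 and I_010 = I_001 = 0. In all other degrees \<open>d\<close> is at least 3, so the
  coframe lives on jets of order \<open>d\<close>.\<close>

lemma invariant_of_order_coeff_inv:
  fixes a b c n :: nat
  assumes "n \<noteq> 1"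
  defines "d \<equiv> (if a + b + c = 2 then 3 else a + b + c)"
  shows "invariant_of_order n (max 3 d) d (coeff_inv a b c)"
proof -
  have "a + b + c = 0 \<or> a + b + c = 1 \<or> 3 \<le> d \<and> a + b + c \<le> d"
    unfolding d_def by (split if_split) arith
  then consider "a + b + c = 0" | "a + b + c = 1" | "3 \<le> d" "a + b + c \<le> d" by blast
  thus ?thesis
  proof cases
    case 1
    hence d: "d = 0" "max 3 d = 3" and abc: "a = 0" "b = 0" "c = 0" by (auto simp: d_def)
    let ?J = "\<lambda>\<theta>::jet. snd \<theta> 0 0 0"
    have "rational_in n 0 (coordinates 0) ?J"
      unfolding rational_in_def
      by (intro bexI[of _ ?J] bexI[of _ "\<lambda>_. 1"] generically_all coordinate_fibre algebra_gen.const) auto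
    moreover have "generically n 0 (\<lambda>\<theta>. ?J (prolong 0 B \<theta>) = ?J \<theta>)" if "det B = 1" for B
    proof (rule generically_all)
      fix \<theta> assume "\<theta> \<in> regular_part n 0"
      thus "?J (prolong 0 B \<theta>) = ?J \<theta>"
        using prolong_regular_part(1)[of "fst \<theta>" "snd \<theta>"] that by simp
    qed
    moreover have "generically n 3 (\<lambda>\<theta>. coeff_inv a b c \<theta> = ?J (truncate 0 \<theta>))"
    proof (rule generically_mono[OF generically_frame[OF assms(1) order_refl]])
      fix \<theta> :: jet assume "det (frame (snd \<theta>)) \<noteq> 0"
      thus "coeff_inv a b c \<theta> = ?J (truncate 0 \<theta>)"
        using coeff_inv_eq[of "snd \<theta>" a b c "fst \<theta>"] by (simp add: abc truncate_def)
    qed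
    ultimately show ?thesis
      unfolding invariant_of_order_def rational_invariant_def d(2) unfolding d(1)
      by (intro exI[of _ ?J]) blast
  next
    case 2
    hence d: "d = 1" "max 3 d = 3" by (auto simp: d_def)
    let ?J = "\<lambda>_::jet. if a = 1 then 1 else 0 :: complex"
    have "rational_invariant n 1 ?J"
      unfolding rational_invariant_def rational_in_def
      by (intro conjI allI impI bexI[of _ ?J] bexI[of _ "\<lambda>_. 1"] generically_all algebra_gen.const) auto
    moreover have "generically n 3 (\<lambda>\<theta>. coeff_inv a b c \<theta> = ?J (truncate 1 \<theta>))"
    proof (rule generically_mono[OF generically_frame[OF assms(1) order_refl]])
      fix \<theta> :: jet assume nondeg: "det (frame (snd \<theta>)) \<noteq> 0"
      let ?C = "frame (snd \<theta>)" and ?I = "pull (inverse3 (frame (snd \<theta>))) (snd \<theta>)"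
      have "gradient ?I = ?C $ 1 v* inverse3 ?C"
        by (simp add: gradient_pull) (simp add: frame_def)
      also have "\<dots> = (?C ** inverse3 ?C) $ 1"
        by (simp add: vec_eq_iff vector_matrix_mult_def matrix_matrix_mult_def mult.commute)
      also have "\<dots> = axis 1 1"
        by (auto simp: inverse3 nondeg mat_def axis_def vec_eq_iff)
      finally have "gradient ?I $ i = (if i = 1 then 1 else 0)" for i by (simp add: axis_def)
      from this[of 1] this[of 2] this[of 3]
      have "?I (Suc 0) 0 0 = 1" "?I 0 (Suc 0) 0 = 0" "?I 0 0 (Suc 0) = 0"
        by (simp_all add: gradient_def)
      moreover have "(a = Suc 0 \<and> b = 0 \<and> c = 0) \<or> (a = 0 \<and> b = Suc 0 \<and> c = 0) \<or> (a = 0 \<and> b = 0 \<and> c = Suc 0)"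
        using 2 by auto
      ultimately show "coeff_inv a b c \<theta> = ?J (truncate 1 \<theta>)"
        using coeff_inv_eq[OF nondeg, of a b c "fst \<theta>"] by auto
    qed
    ultimately show ?thesis
      unfolding invariant_of_order_def d(2) unfolding d(1)
      by (intro exI[of _ ?J]) blast
  next
    case 3
    have "generically n d (\<lambda>\<theta>. coeff_inv a b c \<theta> = coeff_inv a b c (truncate d \<theta>))"
      by (rule generically_all) simp
    thus ?thesis
      using 3 rational_invariant_coeff_inv[OF assms(1) 3]
      unfolding invariant_of_order_def by (auto simp: max_absorb2)
  qed
qed

subsection \<open>The coefficients generate\<close>

text \<open>Without denominators, invariance under \<open>B\<close> is an identity of polynomials
  and extends from generic jets to all regular ones. The matrix may therefore be chosen after the
  jet.\<close>

lemma rational_invariant_cross: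
  assumes J: "generically n k (\<lambda>\<theta>. Q \<theta> \<noteq> 0 \<and> J \<theta> = P \<theta> / Q \<theta>)"
    and PQ: "P \<in> polynomial_functions k" "Q \<in> polynomial_functions k"
    and inv: "generically n k (\<lambda>\<theta>. J (prolong k B \<theta>) = J \<theta>)"
    and B: "det B = 1" and \<theta>: "\<theta> \<in> regular_part n k"
  shows "P (prolong k B \<theta>) * Q \<theta> = P \<theta> * Q (prolong k B \<theta>)"
proof -
  obtain P' where P': "P' \<in> polynomial_functions k"
    "\<And>\<theta>. \<theta> \<in> regular_part n k \<Longrightarrow> P (prolong k B \<theta>) = P' \<theta>"
    using polynomial_prolong[OF PQ(1) B] by blast
  obtain Q' where Q': "Q' \<in> polynomial_functions k"
    "\<And>\<theta>. \<theta> \<in> regular_part n k \<Longrightarrow> Q (prolong k B \<theta>) = Q' \<theta>"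
    using polynomial_prolong[OF PQ(2) B] by blast
  have "generically n k (\<lambda>\<theta>. P' \<theta> * Q \<theta> = P \<theta> * Q' \<theta>)"
    by (rule generically_mono[OF generically_conj[OF generically_conj[OF J generically_prolong[OF J B]] inv]])
      (auto simp: P'(2) Q'(2) frac_eq_eq)
  from generically_eq[OF _ _ this \<theta>] show ?thesis
    using P' Q' PQ \<theta> by (simp add: algebra_gen.mult)
qed


text \<open>Dividing the third row leaves the normalised base point as it is, since its third
  coordinate is 0.\<close>

definition normal_frame :: "family \<Rightarrow> complex^3^3" where
  "normal_frame u = (\<chi> i j. if i = 3 then frame u $ i $ j / det (frame u) else frame u $ i $ j)"

definition normal_scale :: "complex \<Rightarrow> complex^3^3" where
  "normal_scale d = (\<chi> i j. if i = j then (if i = 3 then d else 1) else 0)"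

lemma det_normal_frame: "det (frame u) \<noteq> 0 \<Longrightarrow> det (normal_frame u) = 1"
proof -
  have "det (\<chi> i j. if i = 3 then A $ i $ j / d else A $ i $ j) = det A / d" for A :: "complex^3^3" and d
    by (simp add: det_3 add_divide_distrib diff_divide_distrib)
  thus "det (frame u) \<noteq> 0 \<Longrightarrow> det (normal_frame u) = 1" by (simp add: normal_frame_def)
qed

lemma frame_eq_normal: "det (frame u) \<noteq> 0 \<Longrightarrow> frame u = normal_scale (det (frame u)) ** normal_frame u"
  by (simp add: vec_eq_iff forall_3 matrix_matrix_mult_def normal_scale_def normal_frame_def sum_3)

lemma normal_frame_inverse:
  assumes "det (frame u) \<noteq> 0"
  defines "E \<equiv> inverse3 (frame u) ** normal_scale (det (frame u))"
  shows "E ** normal_frame u = mat 1" "normal_frame u ** E = mat 1"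
proof -
  show "E ** normal_frame u = mat 1"
    using frame_eq_normal[OF assms(1)] inverse3(2)[OF assms(1)]
    by (simp add: E_def flip: matrix_mul_assoc)
  thus "normal_frame u ** E = mat 1"
    using matrix_left_right_inverse by blast
qed

text \<open>
  A numerator and denominator of \<open>J\<close> may both vanish on all normalised jets. This is repaired by a
  constant matrix \<open>B\<close>, chosen such that one jet with nonzero denominator is not moved at all.
\<close>

definition normal_jet :: "complex^3^3 \<Rightarrow> complex^3^3 \<Rightarrow> jet \<Rightarrow> jet" where
  "normal_jet B M \<theta> = (B *v (normal_frame (snd \<theta>) *v fst \<theta>),
     pull M (pull (inverse3 (frame (snd \<theta>)) ** normal_scale (det (frame (snd \<theta>)))) (snd \<theta>)))"

text \<open>Being in the orbit of \<open>\<theta>\<close> gives access to invariance, while the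
  explicit formula of \<open>normal_jet\<close> gives access to rationality.\<close>

lemma prolong_normal_jet:
  assumes \<theta>: "det (frame (snd \<theta>)) \<noteq> 0" and B: "det B = 1" "M ** B = mat 1" "B ** M = mat 1"
  shows "prolong k (B ** normal_frame (snd \<theta>)) (truncate k \<theta>) = truncate k (normal_jet B M \<theta>)"
proof -
  let ?F = "normal_frame (snd \<theta>)"
  define E where "E = inverse3 (frame (snd \<theta>)) ** normal_scale (det (frame (snd \<theta>)))"
  note E = normal_frame_inverse[OF \<theta>, folded E_def]
  have "(E ** M) ** (B ** ?F) = E ** (M ** B) ** ?F" "(B ** ?F) ** (E ** M) = B ** (?F ** E) ** M"
    by (simp_all add: matrix_mul_assoc)
  hence "prolong k (B ** ?F) (truncate k \<theta>) =
      truncate k ((B ** ?F) *v fst \<theta>, pull (E ** M) (snd (truncate k \<theta>)))"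
    using prolong_eq[of "E ** M" "B ** ?F" k "truncate k \<theta>"] E B by (simp add: truncate_def[of k \<theta>])
  also have "\<dots> = truncate k ((B ** ?F) *v fst \<theta>, pull (E ** M) (snd \<theta>))"
    using truncate_pull[of k _ _ "fst \<theta>" "snd \<theta>"] by simp
  finally show ?thesis
    by (simp add: normal_jet_def pull_pull matrix_vector_mul_assoc E_def)
qed

lemma frac_in_normal_scale:
  assumes "w \<in> algebra_gen G" "frac_in G w X d"
  shows "frac_in G w X (\<lambda>x. normal_scale (d x) $ i $ j)"
  by (cases "i = j"; cases "i = 3") (simp_all add: normal_scale_def assms frac_in_const)

lemma frac_in_matrix_vector:
  fixes v :: "'a \<Rightarrow> complex^3"
  assumes "w \<in> algebra_gen G" "\<And>j. frac_in G w X (\<lambda>x. v x $ j)"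
  shows "frac_in G w X (\<lambda>x. (B *v v x) $ i)"
  unfolding matrix_vector_mult_def vec_lambda_beta sum_3
  by (intro frac_in_add frac_in_mult frac_in_const assms)

lemma frac_in_matrix_mult:
  fixes M N :: "'a \<Rightarrow> complex^3^3"
  assumes "w \<in> algebra_gen G" "\<And>i j. frac_in G w X (\<lambda>x. M x $ i $ j)" "\<And>i j. frac_in G w X (\<lambda>x. N x $ i $ j)"
  shows "frac_in G w X (\<lambda>x. (M x ** N x) $ i $ j)"
  unfolding matrix_matrix_mult_def vec_lambda_beta sum_3
  by (intro frac_in_add frac_in_mult assms)

text \<open>Genericity is tested by polynomials in the jet coordinates, so the nonvanishing of a
  denominator at normalised jets has to be expressed in these.\<close>

lemma normal_jet_rational_in_coordinates:
  assumes "3 \<le> l" "k \<le> l" "c \<in> coordinates k"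
  shows "frac_in (coordinates l) (\<lambda>\<theta>. det (frame (snd \<theta>))) {\<theta>. det (frame (snd \<theta>)) \<noteq> 0}
    (\<lambda>\<theta>. c (normal_jet B M \<theta>))"
  using assms(3)
proof (cases rule: coordinates_cases)
  note w = polynomial_det_frame[OF assms(1)]
  let ?F = "frac_in (coordinates l) (\<lambda>\<theta>. det (frame (snd \<theta>))) {\<theta>. det (frame (snd \<theta>)) \<noteq> 0}"
  {
    case (1 i)
    have "?F (\<lambda>\<theta>. normal_frame (snd \<theta>) $ i $ j)" for i j
    proof (cases "i = 3")
      case True
      thus ?thesis
        unfolding normal_frame_def vec_lambda_beta if_P[OF True]
        by (intro frac_in_divide[OF w] frac_in_algebra_gen polynomial_frame[OF assms(1)]) auto
    next
      case False
      thus ?thesis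
        unfolding normal_frame_def vec_lambda_beta if_not_P[OF False]
        by (intro frac_in_algebra_gen polynomial_frame[OF assms(1)])
    qed
    hence "?F (\<lambda>\<theta>. (normal_frame (snd \<theta>) *v fst \<theta>) $ i)" for i
      unfolding matrix_vector_mult_def[of "normal_frame _"] vec_lambda_beta sum_3
      by (intro frac_in_add[OF w] frac_in_mult[OF w] frac_in_algebra_gen[OF coordinate_base])
    thus ?thesis
      unfolding 1 normal_jet_def fst_conv by (rule frac_in_matrix_vector[OF w])
  next
    case (2 a b d)
    show ?thesis
      unfolding 2(1) normal_jet_def snd_conv
      by (intro frac_in_pull[OF w] frac_in_const frac_in_matrix_mult[OF w] frac_in_inverse3
          frac_in_normal_scale[OF w] frac_in_algebra_gen[OF coordinate_fibre] polynomial_frame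
          frac_in_algebra_gen[OF w] assms)
        (use 2(2) assms(2) in auto)
  }
qed

text \<open>The base point is given by \<open>frame_base_point\<close>, and the derivatives are the
  coefficients transformed by diag(1, 1, det C) and the constant \<open>M\<close>. The only
  denominators are powers of I_002 = 1 / det C.\<close>

lemma normal_jet_rational_in_coefficients:
  assumes "3 \<le> l" "k \<le> l" "c \<in> coordinates k"
  shows "frac_in {coeff_inv a b c |a b c. a + b + c \<le> l} (coeff_inv 0 0 2)
    {\<theta> \<in> regular_part n l. det (frame (snd \<theta>)) \<noteq> 0} (\<lambda>\<theta>. c (normal_jet B M \<theta>))"
  using assms(3)
proof (cases rule: coordinates_cases)
  let ?G = "{coeff_inv a b c |a b c. a + b + c \<le> l}"
    and ?X = "{\<theta> \<in> regular_part n l. det (frame (snd \<theta>)) \<noteq> 0}"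
  let ?F = "frac_in ?G (coeff_inv 0 0 2) ?X"
  define V where "V \<theta> = (\<lambda>a b c. coeff_inv a b c \<theta>)" for \<theta>
  have V: "pull (inverse3 (frame (snd \<theta>))) (snd \<theta>) = V \<theta>" if "\<theta> \<in> ?X" for \<theta>
    using that coeff_inv_eq[of "snd \<theta>" _ _ _ "fst \<theta>"] by (simp add: V_def fun_eq_iff)
  have gen: "(\<lambda>\<theta>. V \<theta> a b c) \<in> algebra_gen ?G" if "a + b + c \<le> l" for a b c
    using that by (auto simp: V_def intro!: algebra_gen.gen)
  have w: "coeff_inv 0 0 2 \<in> algebra_gen ?G"
    using gen[of 0 0 2] assms(1) by (simp add: V_def)
  have \<Delta>: "coeff_inv 0 0 2 \<theta> \<noteq> 0" "det (frame (snd \<theta>)) = 1 / coeff_inv 0 0 2 \<theta>" if "\<theta> \<in> ?X" for \<theta>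
  proof -
    have "det (frame (snd \<theta>)) * coeff_inv 0 0 2 \<theta> = 1"
      using det_frame_I002[of "snd \<theta>"] V[OF that] that by (simp add: V_def)
    moreover from this show "coeff_inv 0 0 2 \<theta> \<noteq> 0" by auto
    ultimately show "det (frame (snd \<theta>)) = 1 / coeff_inv 0 0 2 \<theta>"
      by (simp add: eq_divide_eq)
  qed
  have det: "?F (\<lambda>\<theta>. det (frame (snd \<theta>)))"
  proof (rule iffD2[OF frac_in_cong frac_in_divide[OF w frac_in_const]])
    show "det (frame (snd \<theta>)) = 1 / coeff_inv 0 0 2 \<theta>" "coeff_inv 0 0 2 \<theta> \<noteq> 0"
      if "\<theta> \<in> ?X" for \<theta>
      using \<Delta>[OF that] by auto
  qed
  {
    case (1 i)
    have base: "normal_frame (snd \<theta>) *v fst \<theta> = vector [of_nat n * V \<theta> 0 0 0,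
        3 * (of_nat n - 2) * det (hessian (V \<theta>)) * (det (frame (snd \<theta>)))\<^sup>2, 0]" if "\<theta> \<in> ?X" for \<theta>
    proof -
      have "(normal_frame (snd \<theta>) *v fst \<theta>) $ i = (if i = 3 then (frame (snd \<theta>) *v fst \<theta>) $ i / det (frame (snd \<theta>))
          else (frame (snd \<theta>) *v fst \<theta>) $ i)" for i
        by (simp add: matrix_vector_mult_def normal_frame_def sum_3 add_divide_distrib)
      moreover have "V \<theta> 0 0 0 = snd \<theta> 0 0 0" by (simp flip: V[OF that])
      ultimately show ?thesis
        using frame_base_point[of "fst \<theta>" "snd \<theta>" n l] that assms(1) V[OF that]
        by (simp add: vec_eq_iff forall_3)
    qed
    have hess: "?F (\<lambda>\<theta>. det (hessian (V \<theta>)))"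
      by (intro frac_in_algebra_gen algebra_gen_det algebra_gen_hessian gen) (use assms(1) in simp)
    have "?F (\<lambda>\<theta>. (vector [of_nat n * V \<theta> 0 0 0,
        3 * (of_nat n - 2) * det (hessian (V \<theta>)) * (det (frame (snd \<theta>)))\<^sup>2, 0] :: complex^3) $ i)" for i
      using exhaust_3[of i] unfolding power2_eq_square
      by (auto intro!: frac_in_mult[OF w] hess det frac_in_const frac_in_algebra_gen[OF gen])
    hence "?F (\<lambda>\<theta>. (normal_frame (snd \<theta>) *v fst \<theta>) $ i)" for i
      by (subst frac_in_cong) (use base in auto)
    thus ?thesis
      unfolding 1 normal_jet_def fst_conv by (rule frac_in_matrix_vector[OF w])
  next
    case (2 a b d)
    have "?F (\<lambda>\<theta>. pull M (pull (normal_scale (det (frame (snd \<theta>)))) (V \<theta>)) a b d)"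
      by (intro frac_in_pull[OF w] frac_in_const frac_in_normal_scale[OF w] det frac_in_algebra_gen[OF gen])
        (use 2(2) assms(2) in auto)
    moreover have "pull (inverse3 (frame (snd \<theta>)) ** normal_scale d) (snd \<theta>) = pull (normal_scale d) (V \<theta>)"
      if "\<theta> \<in> ?X" for \<theta> d
      using V[OF that] by (metis pull_pull)
    ultimately show ?thesis
      unfolding 2(1) normal_jet_def snd_conv by (subst frac_in_cong) auto
  }
qed

lemma rational_invariant_generated:
  assumes "n \<noteq> 1" "rational_invariant n k J" "3 \<le> l" "k \<le> l"
  shows "rational_in n l {coeff_inv a b c |a b c. a + b + c \<le> l} (\<lambda>\<theta>. J (truncate k \<theta>))"
proof -
  let ?G = "{coeff_inv a b c |a b c. a + b + c \<le> l}"
  let ?w = "\<lambda>\<theta>. det (frame (snd \<theta>))"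
  from assms(2) obtain P Q where PQ: "P \<in> polynomial_functions k" "Q \<in> polynomial_functions k"
    and J: "generically n k (\<lambda>\<theta>. Q \<theta> \<noteq> 0 \<and> J \<theta> = P \<theta> / Q \<theta>)"
    and inv: "\<And>B. det B = 1 \<Longrightarrow> generically n k (\<lambda>\<theta>. J (prolong k B \<theta>) = J \<theta>)"
    unfolding rational_invariant_def rational_in_def by blast
  have "generically n l (\<lambda>\<theta>. Q (truncate k \<theta>) \<noteq> 0 \<and> J (truncate k \<theta>) = P (truncate k \<theta>) / Q (truncate k \<theta>))"
    by (rule generically_truncate[OF J assms(4)])
  hence J': "generically n l (\<lambda>\<theta>. (Q \<theta> \<noteq> 0 \<and> J (truncate k \<theta>) = P \<theta> / Q \<theta>) \<and> ?w \<theta> \<noteq> 0)"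
    using generically_frame[OF assms(1,3)] unfolding polynomial_truncate[OF PQ(1)] polynomial_truncate[OF PQ(2)]
    by (rule generically_conj)
  then obtain \<theta>\<^sub>0 where \<theta>\<^sub>0: "\<theta>\<^sub>0 \<in> regular_part n l" "Q \<theta>\<^sub>0 \<noteq> 0" "?w \<theta>\<^sub>0 \<noteq> 0"
    using generically_ex by blast
  define M where "M = normal_frame (snd \<theta>\<^sub>0)"
  define B where "B = inverse3 (frame (snd \<theta>\<^sub>0)) ** normal_scale (?w \<theta>\<^sub>0)"
  note BM = normal_frame_inverse[OF \<theta>\<^sub>0(3), folded M_def B_def]
  have "det B * det M = 1" using BM by (metis det_I det_mul)
  hence det: "det B = 1" using det_normal_frame[OF \<theta>\<^sub>0(3)] by (simp add: M_def)
  define \<Psi> where "\<Psi> = normal_jet B M"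
  have "\<Psi> \<theta>\<^sub>0 = \<theta>\<^sub>0"
    by (simp add: \<Psi>_def normal_jet_def pull_pull matrix_vector_mul_assoc BM flip: M_def B_def)
  have cross: "P (\<Psi> \<theta>) * Q \<theta> = P \<theta> * Q (\<Psi> \<theta>)" if "\<theta> \<in> regular_part n l" "?w \<theta> \<noteq> 0" for \<theta>
  proof -
    have "det (B ** normal_frame (snd \<theta>)) = 1"
      using det_normal_frame[OF that(2)] det by (simp add: det_mul)
    \<comment> \<open>The matrix depends on \<open>\<theta>\<close>, which is admissible because the
      identity holds at every regular jet.\<close>
    from rational_invariant_cross[OF J PQ inv[OF this] this truncate_mem_regular_part[OF that(1) assms(4)]]
    show ?thesis
      unfolding prolong_normal_jet[OF that(2) det BM(2,1)] \<Psi>_def[symmetric]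
        polynomial_truncate[OF PQ(1)] polynomial_truncate[OF PQ(2)] .
  qed
  obtain N h where h: "h \<in> polynomial_functions l" "\<And>\<theta>. ?w \<theta> \<noteq> 0 \<Longrightarrow> Q (\<Psi> \<theta>) * ?w \<theta> ^ N = h \<theta>"
    using frac_in_compose[OF polynomial_det_frame[OF assms(3)] PQ(2), where \<phi> = "normal_jet B M",
        OF normal_jet_rational_in_coordinates[OF assms(3,4), where B = B and M = M]]
    unfolding frac_in_def \<Psi>_def by blast
  \<comment> \<open>As \<open>\<theta>\<^sub>0\<close> is fixed by the normalisation, the
    denominator there is \<open>Q \<theta>\<^sub>0\<close>, which is nonzero; hence \<open>h\<close>
    certifies that it is generically nonzero.\<close>
  have "h \<theta>\<^sub>0 \<noteq> 0"
    using h(2)[OF \<theta>\<^sub>0(3), symmetric] \<theta>\<^sub>0 by (simp add: \<open>\<Psi> \<theta>\<^sub>0 = \<theta>\<^sub>0\<close>)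
  from generically_conj[OF J' generically_nonzero[OF h(1) \<theta>\<^sub>0(1) this]]
  have gen: "generically n l (\<lambda>\<theta>. ?w \<theta> \<noteq> 0 \<and> Q (\<Psi> \<theta>) \<noteq> 0 \<and> J (truncate k \<theta>) = P (\<Psi> \<theta>) / Q (\<Psi> \<theta>))"
  proof (rule generically_mono)
    fix \<theta>
    assume \<theta>: "\<theta> \<in> regular_part n l"
      and a: "((Q \<theta> \<noteq> 0 \<and> J (truncate k \<theta>) = P \<theta> / Q \<theta>) \<and> ?w \<theta> \<noteq> 0) \<and> h \<theta> \<noteq> 0"
    hence "Q (\<Psi> \<theta>) \<noteq> 0" using h(2)[of \<theta>] by auto
    thus "?w \<theta> \<noteq> 0 \<and> Q (\<Psi> \<theta>) \<noteq> 0 \<and> J (truncate k \<theta>) = P (\<Psi> \<theta>) / Q (\<Psi> \<theta>)"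
      using a cross[OF \<theta>] by (auto simp: frac_eq_eq)
  qed
  have I002: "coeff_inv 0 0 2 \<in> algebra_gen ?G"
    using assms(3) by (intro algebra_gen.gen) force
  have clear: "\<exists>N. \<exists>h \<in> algebra_gen ?G. \<forall>\<theta> \<in> {\<theta> \<in> regular_part n l. ?w \<theta> \<noteq> 0}.
      R (\<Psi> \<theta>) * coeff_inv 0 0 2 \<theta> ^ N = h \<theta>" if "R \<in> polynomial_functions k" for R
    using frac_in_compose[OF I002 that, where \<phi> = "normal_jet B M",
        OF normal_jet_rational_in_coefficients[OF assms(3,4), where n = n and B = B and M = M]]
    unfolding frac_in_def \<Psi>_def .
  obtain N\<^sub>1 p where p: "p \<in> algebra_gen ?G"
    "\<And>\<theta>. \<theta> \<in> regular_part n l \<Longrightarrow> ?w \<theta> \<noteq> 0 \<Longrightarrow> P (\<Psi> \<theta>) * coeff_inv 0 0 2 \<theta> ^ N\<^sub>1 = p \<theta>"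
    using clear[OF PQ(1)] by blast
  obtain N\<^sub>2 q where q: "q \<in> algebra_gen ?G"
    "\<And>\<theta>. \<theta> \<in> regular_part n l \<Longrightarrow> ?w \<theta> \<noteq> 0 \<Longrightarrow> Q (\<Psi> \<theta>) * coeff_inv 0 0 2 \<theta> ^ N\<^sub>2 = q \<theta>"
    using clear[OF PQ(2)] by blast
  \<comment> \<open>Numerator and denominator were cleared with different powers of I_002, hence the
    crosswise factors.\<close>
  have "generically n l (\<lambda>\<theta>. q \<theta> * coeff_inv 0 0 2 \<theta> ^ N\<^sub>1 \<noteq> 0 \<and>
      J (truncate k \<theta>) = (p \<theta> * coeff_inv 0 0 2 \<theta> ^ N\<^sub>2) / (q \<theta> * coeff_inv 0 0 2 \<theta> ^ N\<^sub>1))"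
    using gen
  proof (rule generically_mono)
    fix \<theta>
    assume \<theta>: "\<theta> \<in> regular_part n l"
      and a: "?w \<theta> \<noteq> 0 \<and> Q (\<Psi> \<theta>) \<noteq> 0 \<and> J (truncate k \<theta>) = P (\<Psi> \<theta>) / Q (\<Psi> \<theta>)"
    have "coeff_inv 0 0 2 \<theta> \<noteq> 0"
      using det_frame_I002[of "snd \<theta>"] coeff_inv_eq[of "snd \<theta>" 0 0 2 "fst \<theta>"] a by auto
    thus "q \<theta> * coeff_inv 0 0 2 \<theta> ^ N\<^sub>1 \<noteq> 0 \<and>
      J (truncate k \<theta>) = (p \<theta> * coeff_inv 0 0 2 \<theta> ^ N\<^sub>2) / (q \<theta> * coeff_inv 0 0 2 \<theta> ^ N\<^sub>1)"
      using a p(2)[OF \<theta>, symmetric] q(2)[OF \<theta>, symmetric] by simp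
  qed
  thus ?thesis
    unfolding rational_in_def
    by (intro bexI[of _ "\<lambda>\<theta>. p \<theta> * coeff_inv 0 0 2 \<theta> ^ N\<^sub>2"] bexI[of _ "\<lambda>\<theta>. q \<theta> * coeff_inv 0 0 2 \<theta> ^ N\<^sub>1"]
        algebra_gen.mult algebra_gen_power p q I002)
qed

theorem theorem32:
  fixes n :: nat
  assumes "n \<noteq> 1"
  shows "(\<forall>i j k. let d = (if i + j + k = 2 then 3 else i + j + k) in
            invariant_of_order n (max 3 d) d (coeff_inv i j k)) \<and>
         (\<forall>k J. rational_invariant n k J \<longrightarrow>
            (\<exists>l \<ge> max 3 k. rational_in n l {coeff_inv a b c |a b c. a + b + c \<le> l}
               (\<lambda>\<theta>. J (truncate k \<theta>))))"
proof (intro conjI allI impI)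
  fix i j k
  show "let d = (if i + j + k = 2 then 3 else i + j + k) in
      invariant_of_order n (max 3 d) d (coeff_inv i j k)"
    unfolding Let_def by (rule invariant_of_order_coeff_inv[OF assms])
next
  fix k J assume "rational_invariant n k J"
  from rational_invariant_generated[OF assms this, of "max 3 k"]
  show "\<exists>l \<ge> max 3 k. rational_in n l {coeff_inv a b c |a b c. a + b + c \<le> l} (\<lambda>\<theta>. J (truncate k \<theta>))"
    by (intro exI[of _ "max 3 k"]) simp
qed

end
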